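(* Let $n\ge2$ and let $\Omega$ be a bounded $s$-John domain in $\mathbb{R}^n$ with $1\le s<\frac{n}{n-1}$. If $\delta\in(0,n]$ and $p>\delta/n$, then there is a constant $c$ depending only on $n,\delta,p,\Omega$ such that \[ \inf_{b\in\mathbb{R}}\int_\Omega|u(x)-b|^p\,d\mathcal{H}^{\delta}_\infty\le c\int_\Omega|\nabla u(x)|^p\,d\mathcal{H}^{\delta}_\infty \] for all $u\in C^1(\Omega)$.
   Context: Let $s\ge1$. A bounded domain (open connected set) $\Omega\subset\mathbb{R}^n$ is an $s$-John domain if there are finite positive constants $c_J,C_J$ and a point $x_0\in\Omega$ such that every $x\in\Omega$ can be joined to $x_0$ by a rectifiable curve $\gamma_x:[0,\ell(\gamma_x)]\to\Omega$ parametrised by arc length with $\gamma_x(0)=x$, $\gamma_x(\ell(\gamma_x))=x_0$, $\ell(\gamma_x)\le C_J$, and $\operatorname{dist}(\gamma_x(t),\partial\Omega)\ge c_J t^s$ for all $t\in[0,\ell(\gamma_x)]$. For $E\subset\mathbb{R}^n$ and $\beta\in(0,n]$, $\mathcal{H}^{\beta}_\infty(E)=\inf\{\sum_i r_i^{\beta}: E\subset\bigcup_i B(x_i,r_i)\}$ over countable or finite coverings by open balls. For $f:\Omega\to[0,\infty]$, $\int_\Omega f\,d\mathcal{H}^{\beta}_\infty:=\int_0^\infty \mathcal{H}^{\beta}_\infty(\{x\in\Omega: f(x)>t\})\,dt$. *)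

theory Defs
  imports "HOL-Analysis.Analysis"
begin

definition curve_length :: "(real \<Rightarrow> 'a::metric_space) \<Rightarrow> real \<Rightarrow> real \<Rightarrow> ennreal" where
  "curve_length \<gamma> a b =
     (SUP (m, t) \<in> {(m::nat, t::nat \<Rightarrow> real). t 0 = a \<and> t m = b \<and> (\<forall>i<m. t i \<le> t (Suc i))}.
        ennreal (\<Sum>i<m. dist (\<gamma> (t (Suc i))) (\<gamma> (t i))))"

definition arclength_param :: "(real \<Rightarrow> 'a::metric_space) \<Rightarrow> real \<Rightarrow> bool" where
  "arclength_param \<gamma> l \<longleftrightarrow> l \<ge> 0 \<and>
     (\<forall>a b. 0 \<le> a \<longrightarrow> a \<le> b \<longrightarrow> b \<le> l \<longrightarrow> curve_length \<gamma> a b = ennreal (b - a))"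

definition s_John_domain :: "real \<Rightarrow> 'a::euclidean_space set \<Rightarrow> bool" where
  "s_John_domain s \<Omega> \<longleftrightarrow> s \<ge> 1 \<and> open \<Omega> \<and> connected \<Omega> \<and> \<Omega> \<noteq> {} \<and> bounded \<Omega> \<and>
     (\<exists>cJ CJ x0. cJ > 0 \<and> CJ > 0 \<and> x0 \<in> \<Omega> \<and>
        (\<forall>x\<in>\<Omega>. \<exists>\<gamma> l. arclength_param \<gamma> l \<and> \<gamma> 0 = x \<and> \<gamma> l = x0 \<and> l \<le> CJ \<and>
            (\<forall>t\<in>{0..l}. \<gamma> t \<in> \<Omega> \<and> infdist (\<gamma> t) (- \<Omega>) \<ge> cJ * t powr s)))"

text \<open>Hausdorff content \<H>^\<beta>_\<infinity>: countable (or finite, via zero radii) coverings by open balls.\<close>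
definition hausdorff_content :: "real \<Rightarrow> 'a::euclidean_space set \<Rightarrow> ennreal" where
  "hausdorff_content \<beta> E =
     (INF (c, r) \<in> {(c::nat \<Rightarrow> 'a, r::nat \<Rightarrow> real). (\<forall>i. r i \<ge> 0) \<and> E \<subseteq> (\<Union>i. ball (c i) (r i))}.
        (\<Sum>i. ennreal (r i powr \<beta>)))"

definition choquet_integral :: "real \<Rightarrow> 'a::euclidean_space set \<Rightarrow> ('a \<Rightarrow> real) \<Rightarrow> ennreal" where
  "choquet_integral \<beta> \<Omega> f =
     (\<integral>\<^sup>+ t. indicator {0..} t * hausdorff_content \<beta> {x\<in>\<Omega>. f x > t} \<partial>lborel)"

end

theory Submission
  imports Defs
begin

text \<open>
  Write \<open>n\<close> for the dimension and \<open>M\<close> for the Hardy--Littlewood maximal operator.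

  Pointwise bound \<open>\<bar>u x - b\<bar> \<le> C M\<bar>\<nabla>u\<bar>(x)\<close>: follow the John curve \<open>\<gamma>\<close> from \<open>x\<close> through the dyadic
  scales \<open>t \<approx> T\<close>. At scale \<open>T\<close> one has room for balls of radius \<open>R \<approx> T\<^sup>s\<close>, and a chain of such balls
  with bounded overlap leads from \<open>\<gamma> (T / 2)\<close> to \<open>\<gamma> T\<close>; the mean of \<open>u\<close> changes along it by at most
  \<open>C R\<^bsup>1-n\<^esup> \<integral> \<bar>\<nabla>u\<bar>\<close> over \<open>ball x (2 T)\<close>, that is by \<open>C T\<^bsup>n-s(n-1)\<^esup> M\<bar>\<nabla>u\<bar>(x)\<close>, and these bounds
  form a convergent geometric series since \<open>s < n / (n - 1)\<close>. The value \<open>b\<close> is the mean over a fixed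
  ball around \<open>x0\<close>.

  Maximal inequality for the content: cover each level set \<open>{f > 2\<^sup>k}\<close> almost optimally by balls, which
  dominates \<open>f\<close> by a sum of multiples of indicators of balls. A Vitali argument gives
  a weak-type estimate with exponent \<open>\<delta> / n \<le> 1\<close> for such sums, and summing over dyadic levels
  upgrades it to exponents \<open>p > \<delta> / n\<close>. No subadditivity of the Choquet integral is needed.
\<close>

section \<open>John curves\<close>

lemma arclength_param_dist_le:
  assumes "arclength_param \<gamma> l" "0 \<le> a" "a \<le> b" "b \<le> l"
  shows "dist (\<gamma> a) (\<gamma> b) \<le> b - a"
proof -
  define t where "t = (\<lambda>i::nat. if i = 0 then a else b)"
  have "ennreal (dist (\<gamma> b) (\<gamma> a)) \<le> curve_length \<gamma> a b"
    unfolding curve_length_def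
    by (rule SUP_upper2[where i="(1,t)"]) (use assms in \<open>auto simp: t_def\<close>)
  also have "\<dots> = ennreal (b - a)"
    using assms by (simp add: arclength_param_def)
  finally show ?thesis
    using assms by (simp add: dist_commute)
qed

text \<open>Continuing the John curves by the constant \<open>x0\<close> puts all of them on one common interval.\<close>

lemma s_John_domain_curves:
  fixes \<Omega> :: "'a::euclidean_space set"
  assumes "s_John_domain s \<Omega>"
  obtains c L x0 where "c > 0" "L > 0" "x0 \<in> \<Omega>"
    "\<And>t. 0 \<le> t \<Longrightarrow> t \<le> L \<Longrightarrow> c * t powr s \<le> t"
    "\<And>x. x \<in> \<Omega> \<Longrightarrow> \<exists>\<gamma>. \<gamma> 0 = x \<and> \<gamma> L = x0 \<and>
        (\<forall>a b. 0 \<le> a \<longrightarrow> a \<le> b \<longrightarrow> b \<le> L \<longrightarrow> dist (\<gamma> a) (\<gamma> b) \<le> b - a) \<and>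
        (\<forall>t\<in>{0..L}. ball (\<gamma> t) (c * t powr s) \<subseteq> \<Omega>)"
proof -
  from assms obtain cJ L x0 where s: "s \<ge> 1" and op: "open \<Omega>" and cJ: "cJ > 0" and L: "L > 0"
    and x0: "x0 \<in> \<Omega>" and J: "\<And>x. x \<in> \<Omega> \<Longrightarrow> \<exists>\<gamma> l. arclength_param \<gamma> l \<and> \<gamma> 0 = x \<and> \<gamma> l = x0 \<and> l \<le> L \<and>
            (\<forall>t\<in>{0..l}. \<gamma> t \<in> \<Omega> \<and> infdist (\<gamma> t) (- \<Omega>) \<ge> cJ * t powr s)"
    unfolding s_John_domain_def by metis
  obtain e where e: "e > 0" "ball x0 e \<subseteq> \<Omega>"
    using op x0 openE by blast
  \<comment> \<open>The three terms serve three purposes: \<open>cJ\<close> keeps the John condition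
    up to time \<open>l\<close>; \<open>e / L powr s\<close> keeps the ball of radius
    \<open>c * t powr s\<close> inside \<Omega> while the continued curve rests at
    \<open>x0\<close>; \<open>L powr (1 - s)\<close> gives \<open>c * t powr s \<le> t\<close>,
    because \<open>t powr (1 - s)\<close> is decreasing in \<open>t\<close>.\<close>
  define c where "c = min cJ (min (e / L powr s) (L powr (1 - s)))"
  have c: "c > 0" "c \<le> cJ" "c \<le> e / L powr s" "c \<le> L powr (1 - s)"
    using cJ e L by (auto simp: c_def)
  have ct: "c * t powr s \<le> t" if "0 \<le> t" "t \<le> L" for t
  proof (cases "t = 0")
    case False
    then have t: "t > 0" using that by simp
    have "c * t powr s \<le> L powr (1 - s) * t powr s"
      using c by (intro mult_right_mono) auto
    also have "\<dots> \<le> t powr (1 - s) * t powr s"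
      using t that s by (intro mult_right_mono powr_mono2') auto
    also have "\<dots> = t" using t by (simp flip: powr_add)
    finally show ?thesis .
  qed (use s in simp)
  show thesis
  proof (rule that[OF c(1) L x0 ct])
    fix x assume "x \<in> \<Omega>"
    from J[OF this] obtain \<gamma> l where g: "arclength_param \<gamma> l" "\<gamma> 0 = x" "\<gamma> l = x0" "l \<le> L"
      and gt: "\<And>t. t \<in> {0..l} \<Longrightarrow> infdist (\<gamma> t) (- \<Omega>) \<ge> cJ * t powr s" by blast
    have l: "l \<ge> 0" using g by (simp add: arclength_param_def)
    have d: "dist (\<gamma> (min a l)) (\<gamma> (min b l)) \<le> b - a" if "0 \<le> a" "a \<le> b" for a b
    proof -
      have "dist (\<gamma> (min a l)) (\<gamma> (min b l)) \<le> min b l - min a l"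
        using that l by (intro arclength_param_dist_le[OF g(1)]) auto
      then show ?thesis using that by linarith
    qed
    have "ball (\<gamma> (min t l)) (c * t powr s) \<subseteq> \<Omega>" if t: "t \<in> {0..L}" for t
    proof (cases "t \<le> l")
      case True
      show ?thesis
      proof
        fix y assume y: "y \<in> ball (\<gamma> (min t l)) (c * t powr s)"
        show "y \<in> \<Omega>"
        proof (rule ccontr)
          assume "y \<notin> \<Omega>"
          then have "infdist (\<gamma> t) (- \<Omega>) \<le> dist (\<gamma> t) y" by (intro infdist_le) auto
          also have "\<dots> < c * t powr s" using y True by simp
          also have "\<dots> \<le> cJ * t powr s" using c by (intro mult_right_mono) auto
          finally show False using gt[of t] t True by auto
        qed
      qed
    next
      case False
      have "c * t powr s \<le> e / L powr s * L powr s"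
        using c t s L e by (intro mult_mono powr_mono2) auto
      also have "\<dots> = e" using L by simp
      finally have "ball x0 (c * t powr s) \<subseteq> ball x0 e" by (rule subset_ball)
      then show ?thesis using False e g by auto
    qed
    then show "\<exists>\<gamma>. \<gamma> 0 = x \<and> \<gamma> L = x0 \<and>
        (\<forall>a b. 0 \<le> a \<longrightarrow> a \<le> b \<longrightarrow> b \<le> L \<longrightarrow> dist (\<gamma> a) (\<gamma> b) \<le> b - a) \<and>
        (\<forall>t\<in>{0..L}. ball (\<gamma> t) (c * t powr s) \<subseteq> \<Omega>)"
      using d g l L by (intro exI[of _ "\<lambda>t. \<gamma> (min t l)"]) (auto simp: min_def)
  qed
qed

section \<open>Averages over moving balls and bounded overlap\<close>

lemma nn_integral_lborel_affine:
  fixes h :: "'a::euclidean_space \<Rightarrow> ennreal"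
  assumes [measurable]: "h \<in> borel_measurable borel" and c: "c > 0"
  shows "(\<integral>\<^sup>+ x. h x \<partial>lborel) = ennreal (c ^ DIM('a)) * (\<integral>\<^sup>+ z. h (t + c *\<^sub>R z) \<partial>lborel)"
  using c by (subst lborel_affine[of c t])
    (simp_all add: nn_integral_density nn_integral_distr nn_integral_cmult)

text \<open>Fundamental theorem of calculus along the segment, followed by Cauchy-Schwarz. The bound
  is a nonnegative integral so that Tonelli applies to it later without integrability
  conditions.\<close>

lemma abs_diff_le_nn_integral_gradient:
  fixes u :: "'a::euclidean_space \<Rightarrow> real"
  assumes d: "\<And>x. x \<in> \<Omega> \<Longrightarrow> (u has_derivative (\<lambda>h. g x \<bullet> h)) (at x)"
    and g: "continuous_on \<Omega> g"
    and seg: "\<And>\<tau>. \<tau> \<in> {0..1} \<Longrightarrow> a + \<tau> *\<^sub>R (b - a) \<in> \<Omega>"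
  shows "ennreal \<bar>u b - u a\<bar> \<le>
    (\<integral>\<^sup>+ \<tau>. indicator {0..1} \<tau> * ennreal (norm (g (a + \<tau> *\<^sub>R (b - a))) * dist a b) \<partial>lborel)"
proof -
  let ?p = "\<lambda>\<tau>. a + \<tau> *\<^sub>R (b - a)"
  have "((\<lambda>\<tau>. g (?p \<tau>) \<bullet> (b - a)) has_integral (u (?p 1) - u (?p 0))) {0..1}"
  proof (rule fundamental_theorem_of_calculus)
    fix \<tau> :: real assume "\<tau> \<in> {0..1}"
    then have "(u has_derivative (\<lambda>h. g (?p \<tau>) \<bullet> h)) (at (?p \<tau>))"
      using d seg by blast
    moreover have "(?p has_derivative (\<lambda>h. h *\<^sub>R (b - a))) (at \<tau> within {0..1})"
      by (auto intro!: derivative_eq_intros)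
    ultimately have "((\<lambda>\<tau>. u (?p \<tau>)) has_derivative (\<lambda>h. g (?p \<tau>) \<bullet> (h *\<^sub>R (b - a)))) (at \<tau> within {0..1})"
      by (rule has_derivative_compose[rotated])
    then show "((\<lambda>\<tau>. u (?p \<tau>)) has_vector_derivative g (?p \<tau>) \<bullet> (b - a)) (at \<tau> within {0..1})"
      by (simp add: has_vector_derivative_def)
  qed simp
  then have 1: "((\<lambda>\<tau>. g (?p \<tau>) \<bullet> (b - a)) has_integral (u b - u a)) {0..1}" by simp
  have "continuous_on {0..1} (\<lambda>\<tau>. g (?p \<tau>))"
    by (rule continuous_on_compose2[OF g]) (use seg in \<open>auto intro!: continuous_intros\<close>)
  then have "(\<lambda>\<tau>. norm (g (?p \<tau>)) * dist a b) integrable_on {0..1}"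
    by (intro integrable_continuous_interval continuous_intros)
  then have 2: "((\<lambda>\<tau>. norm (g (?p \<tau>)) * dist a b) has_integral
       integral {0..1} (\<lambda>\<tau>. norm (g (?p \<tau>)) * dist a b)) {0..1}" by (rule integrable_integral)
  have "norm (integral {0..1} (\<lambda>\<tau>. g (?p \<tau>) \<bullet> (b - a))) \<le> integral {0..1} (\<lambda>\<tau>. norm (g (?p \<tau>)) * dist a b)"
    using 1 2 Cauchy_Schwarz_ineq2[of "g (?p _)" "b - a"]
    by (intro integral_norm_bound_integral) (auto simp: dist_norm norm_minus_commute dest: has_integral_integrable)
  then have "norm (u b - u a) \<le> integral {0..1} (\<lambda>\<tau>. norm (g (?p \<tau>)) * dist a b)"
    using 1 by (simp add: integral_unique)
  then show ?thesis
    using nn_integral_has_integral_lebesgue[OF _ 2] by (simp add: ennreal_leI ennreal_mult ennreal_indicator mult_ac)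
qed

text \<open>Both balls are parametrised by the unit ball, and each \<open>z\<close> travels in a
  straight line from \<open>p + \<rho> *\<^sub>R z\<close> to
  \<open>p' + \<rho>' *\<^sub>R z\<close>, a distance of at most \<open>D\<close>. At a fixed time
  \<tau> the map of \<open>z\<close> is affine with dilation factor at least \<open>r\<close>, so
  the change of variables costs at most \<open>1 / r ^ DIM('a)\<close>.\<close>

lemma nn_integral_ball_abs_diff_le:
  fixes u :: "'a::euclidean_space \<Rightarrow> real"
  assumes d: "\<And>x. x \<in> \<Omega> \<Longrightarrow> (u has_derivative (\<lambda>h. g x \<bullet> h)) (at x)"
    and g: "continuous_on \<Omega> g"
    and W: "W \<in> sets borel" "W \<subseteq> \<Omega>"
    and sub: "\<And>\<tau>. \<tau> \<in> {0..1} \<Longrightarrow> ball (p + \<tau> *\<^sub>R (p' - p)) (\<rho> + \<tau> * (\<rho>' - \<rho>)) \<subseteq> W"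
    and r: "0 < r" "r \<le> \<rho>" "r \<le> \<rho>'"
    and D: "dist p p' + \<bar>\<rho> - \<rho>'\<bar> \<le> D"
  shows "(\<integral>\<^sup>+ z \<in> ball 0 1. ennreal \<bar>u (p' + \<rho>' *\<^sub>R z) - u (p + \<rho> *\<^sub>R z)\<bar> \<partial>lborel)
    \<le> ennreal (D / r ^ DIM('a)) * (\<integral>\<^sup>+ y \<in> W. ennreal (norm (g y)) \<partial>lborel)"
proof -
  have D0: "D \<ge> 0" using D zero_le_dist[of p p'] by linarith
  \<comment> \<open>Cutting off outside \<open>W\<close> makes the integrand Borel on the whole
    space, whereas \<open>g\<close> is controlled only on \<Omega>.\<close>
  define F where "F = (\<lambda>y. ennreal (norm (indicator W y *\<^sub>R g y)))"
  have [measurable]: "F \<in> borel_measurable borel"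
    unfolding F_def using borel_measurable_continuous_on_indicator[OF W(1) continuous_on_subset[OF g W(2)]]
    by measurable
  have intF: "(\<integral>\<^sup>+ y. F y \<partial>lborel) = (\<integral>\<^sup>+ y \<in> W. ennreal (norm (g y)) \<partial>lborel)"
    by (intro nn_integral_cong) (auto simp: F_def indicator_def)
  define X where "X = (\<lambda>\<tau>. p + \<tau> *\<^sub>R (p' - p))"
  define P where "P = (\<lambda>\<tau>. \<rho> + \<tau> * (\<rho>' - \<rho>))"
  \<comment> \<open>The intermediate radius is a convex combination of \<rho> and \<rho>', both at
    least \<open>r\<close>.\<close>
  have P: "P \<tau> \<ge> r" if "\<tau> \<in> {0..1}" for \<tau>
  proof -
    have "P \<tau> = (1 - \<tau>) * \<rho> + \<tau> * \<rho>'" by (simp add: P_def algebra_simps)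
    also have "\<dots> \<ge> (1 - \<tau>) * r + \<tau> * r"
      using that r by (intro add_mono mult_left_mono) auto
    finally show ?thesis by (simp add: algebra_simps)
  qed
  have XP[measurable]: "X \<in> borel_measurable borel" "P \<in> borel_measurable borel"
    unfolding X_def P_def by measurable
  have "(\<integral>\<^sup>+ z \<in> ball 0 1. ennreal \<bar>u (p' + \<rho>' *\<^sub>R z) - u (p + \<rho> *\<^sub>R z)\<bar> \<partial>lborel)
     \<le> (\<integral>\<^sup>+ z. \<integral>\<^sup>+ \<tau>. indicator {0..1} \<tau> * (F (X \<tau> + P \<tau> *\<^sub>R z) * ennreal D) \<partial>lborel \<partial>lborel)"
  proof (rule nn_integral_mono, goal_cases)
    case (1 z)
    show ?case
    proof (cases "z \<in> ball 0 1")
      case z: True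
      let ?a = "p + \<rho> *\<^sub>R z" and ?b = "p' + \<rho>' *\<^sub>R z"
      have eq: "?a + \<tau> *\<^sub>R (?b - ?a) = X \<tau> + P \<tau> *\<^sub>R z" for \<tau>
        by (simp add: X_def P_def algebra_simps)
      have inW: "X \<tau> + P \<tau> *\<^sub>R z \<in> W" if "\<tau> \<in> {0..1}" for \<tau>
      proof -
        have "P \<tau> * norm z < P \<tau> * 1"
          using P[OF that] r z by (intro mult_strict_left_mono) auto
        then have "X \<tau> + P \<tau> *\<^sub>R z \<in> ball (X \<tau>) (P \<tau>)"
          using P[OF that] r by (simp add: dist_norm)
        then show ?thesis using sub[OF that] unfolding X_def P_def by blast
      qed
      have "?a - ?b = (p - p') + (\<rho> - \<rho>') *\<^sub>R z" by (simp add: algebra_simps)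
      then have "dist ?a ?b \<le> dist p p' + \<bar>\<rho> - \<rho>'\<bar> * norm z"
        unfolding dist_norm by (metis norm_scaleR norm_triangle_ineq)
      also have "\<dots> \<le> dist p p' + \<bar>\<rho> - \<rho>'\<bar> * 1"
        using z by (intro add_left_mono mult_left_mono) auto
      finally have dab: "dist ?a ?b \<le> D" using D by simp
      have "ennreal \<bar>u ?b - u ?a\<bar> \<le>
        (\<integral>\<^sup>+ \<tau>. indicator {0..1} \<tau> * ennreal (norm (g (?a + \<tau> *\<^sub>R (?b - ?a))) * dist ?a ?b) \<partial>lborel)"
        using inW W by (intro abs_diff_le_nn_integral_gradient[OF d g]) (auto simp: eq)
      also have "\<dots> \<le> (\<integral>\<^sup>+ \<tau>. indicator {0..1} \<tau> * (F (X \<tau> + P \<tau> *\<^sub>R z) * ennreal D) \<partial>lborel)"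
        unfolding eq using inW dab D0
        by (intro nn_integral_mono)
           (auto simp: indicator_def F_def ennreal_mult[symmetric] intro!: ennreal_leI mult_left_mono)
      finally show ?thesis using z by simp
    qed simp
  qed
  \<comment> \<open>With the time integral outside, the inner integral over \<open>z\<close> can be
    handled by the affine change of variables.\<close>
  also have "\<dots> = (\<integral>\<^sup>+ \<tau>. \<integral>\<^sup>+ z. indicator {0..1} \<tau> * (F (X \<tau> + P \<tau> *\<^sub>R z) * ennreal D) \<partial>lborel \<partial>lborel)"
    by (rule lborel_pair.Fubini') measurable
  also have "\<dots> \<le> (\<integral>\<^sup>+ (\<tau>::real). indicator {0..1} \<tau> * (ennreal (D / r ^ DIM('a)) * (\<integral>\<^sup>+ y. F y \<partial>lborel)) \<partial>lborel)"
  proof (rule nn_integral_mono, goal_cases)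
    case (1 \<tau>)
    show ?case
    proof (cases "\<tau> \<in> {0..1::real}")
      case True
      have Pp: "P \<tau> > 0" using P[OF True] r by linarith
      have "ennreal (r ^ DIM('a)) * (\<integral>\<^sup>+ z. F (X \<tau> + P \<tau> *\<^sub>R z) \<partial>lborel)
          \<le> ennreal (P \<tau> ^ DIM('a)) * (\<integral>\<^sup>+ z. F (X \<tau> + P \<tau> *\<^sub>R z) \<partial>lborel)"
        using P[OF True] r by (intro mult_right_mono ennreal_leI power_mono) auto
      also have "\<dots> = (\<integral>\<^sup>+ y. F y \<partial>lborel)"
        using nn_integral_lborel_affine[of F "P \<tau>" "X \<tau>"] Pp by simp
      finally have *: "ennreal (r ^ DIM('a)) * (\<integral>\<^sup>+ z. F (X \<tau> + P \<tau> *\<^sub>R z) \<partial>lborel) \<le> (\<integral>\<^sup>+ y. F y \<partial>lborel)" .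
      have "(\<integral>\<^sup>+ z. F (X \<tau> + P \<tau> *\<^sub>R z) * ennreal D \<partial>lborel)
          = (\<integral>\<^sup>+ z. F (X \<tau> + P \<tau> *\<^sub>R z) \<partial>lborel) * ennreal D"
        by (rule nn_integral_multc) measurable
      also have "\<dots> = ennreal (D / r ^ DIM('a)) * (ennreal (r ^ DIM('a)) * (\<integral>\<^sup>+ z. F (X \<tau> + P \<tau> *\<^sub>R z) \<partial>lborel))"
        using r D0 by (simp add: mult.assoc[symmetric] ennreal_mult[symmetric] mult.commute)
      also have "\<dots> \<le> ennreal (D / r ^ DIM('a)) * (\<integral>\<^sup>+ y. F y \<partial>lborel)"
        using * by (rule mult_left_mono) simp
      finally show ?thesis using True by simp
    qed simp
  qed
  also have "\<dots> = ennreal (D / r ^ DIM('a)) * (\<integral>\<^sup>+ y. F y \<partial>lborel)"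
    by (subst nn_integral_multc) auto
  finally show ?thesis by (simp add: intF)
qed

text \<open>A shortest chain has the last property: if two points that are not neighbours were close, it could be cut short.\<close>

lemma minimal_chain:
  fixes p0 :: "nat \<Rightarrow> 'a::metric_space"
  assumes "\<And>i. i \<le> m0 \<Longrightarrow> p0 i \<in> K" "\<And>i. i < m0 \<Longrightarrow> dist (p0 i) (p0 (Suc i)) \<le> R"
  obtains m p where "p 0 = p0 0" "p m = p0 m0" "\<And>i. i \<le> m \<Longrightarrow> p i \<in> K"
    "\<And>i. i < m \<Longrightarrow> dist (p i) (p (Suc i)) \<le> R"
    "\<And>i j. i + 2 \<le> j \<Longrightarrow> j \<le> m \<Longrightarrow> dist (p i) (p j) > R"
proof -
  define C where "C = (\<lambda>m. \<exists>p. p 0 = p0 0 \<and> p m = p0 m0 \<and> (\<forall>i\<le>m. p i \<in> K) \<and>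
     (\<forall>i<m. dist (p i) (p (Suc i)) \<le> R))"
  have "C m0" using assms unfolding C_def by blast
  define m where "m = (LEAST m. C m)"
  have "C m" unfolding m_def using \<open>C m0\<close> by (rule LeastI)
  then obtain p where p: "p 0 = p0 0" "p m = p0 m0" "\<And>i. i \<le> m \<Longrightarrow> p i \<in> K"
    "\<And>i. i < m \<Longrightarrow> dist (p i) (p (Suc i)) \<le> R" unfolding C_def by blast
  show thesis
  proof (rule that[OF p])
    fix i j assume ij: "i + 2 \<le> j" "j \<le> m"
    show "dist (p i) (p j) > R"
    proof (rule ccontr)
      assume "\<not> dist (p i) (p j) > R"
      then have le: "dist (p i) (p j) \<le> R" by simp
      define e where "e = j - i - 1"
      have e: "e \<ge> 1" "j = Suc i + e" using ij by (auto simp: e_def)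
      \<comment> \<open>The shortcut jumps from \<open>p i\<close> straight to \<open>p j\<close>,
        leaving out the \<open>e\<close> points in between; its existence contradicts the minimality
        of \<open>m\<close>.\<close>
      define q where "q = (\<lambda>k. if k \<le> i then p k else p (k + e))"
      have "dist (q k) (q (Suc k)) \<le> R" if "k < m - e" for k
        using p(4)[of k] p(4)[of "k+e"] that ij e le by (cases "k = i") (auto simp: q_def)
      moreover have "q k \<in> K" if "k \<le> m - e" for k
        using p(3)[of k] p(3)[of "k+e"] that ij e by (auto simp: q_def)
      ultimately have "C (m - e)" unfolding C_def
        using p(1,2) ij e by (intro exI[of _ q]) (auto simp: q_def)
      then have "m \<le> m - e" unfolding m_def by (rule Least_le)
      then show False using e ij by linarith
    qed
  qed
qed

text \<open>Volume comparison: the balls of radius \<open>R / 2\<close> around the points are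
  disjoint and lie in the ball of radius \<open>5 * R / 2\<close> around \<open>y\<close>.\<close>

lemma card_separated_le:
  fixes p :: "'i \<Rightarrow> 'a::euclidean_space"
  assumes "finite S" and R: "R > 0"
    and sep: "\<And>i j. i \<in> S \<Longrightarrow> j \<in> S \<Longrightarrow> i \<noteq> j \<Longrightarrow> dist (p i) (p j) \<ge> R"
    and near: "\<And>i. i \<in> S \<Longrightarrow> dist y (p i) < 2 * R"
  shows "card S \<le> 5 ^ DIM('a)"
proof -
  let ?v = "unit_ball_vol (DIM('a))"
  have v: "?v > 0" by (rule unit_ball_vol_pos) simp
  have dis: "disjoint_family_on (\<lambda>i. ball (p i) (R / 2)) S"
    unfolding disjoint_family_on_def
  proof (intro ballI impI)
    fix i j assume "i \<in> S" "j \<in> S" "i \<noteq> j"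
    then have "dist (p i) (p j) \<ge> R" by (rule sep)
    then show "ball (p i) (R / 2) \<inter> ball (p j) (R / 2) = {}"
      by (intro disjoint_ballI) simp
  qed
  have "(\<Sum>i\<in>S. emeasure lborel (ball (p i) (R / 2))) = emeasure lborel (\<Union>i\<in>S. ball (p i) (R / 2))"
    using dis \<open>finite S\<close> by (intro sum_emeasure) auto
  also have "\<dots> \<le> emeasure lborel (ball y (5 * R / 2))"
  proof (rule emeasure_mono)
    show "(\<Union>i\<in>S. ball (p i) (R / 2)) \<subseteq> ball y (5 * R / 2)"
    proof clarify
      fix i z assume "i \<in> S" "z \<in> ball (p i) (R / 2)"
      then show "z \<in> ball y (5 * R / 2)"
        using near[of i] dist_triangle[of y z "p i"] by auto
    qed
  qed simp
  finally have "ennreal (real (card S) * (?v * (R / 2) ^ DIM('a))) \<le> ennreal (?v * (5 * R / 2) ^ DIM('a))"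
    using R v by (simp add: emeasure_ball ennreal_mult ennreal_of_nat_eq_real_of_nat)
  then have "real (card S) * (?v * (R / 2) ^ DIM('a)) \<le> ?v * (5 * R / 2) ^ DIM('a)"
    using R v by (simp add: ennreal_le_iff)
  also have "\<dots> = 5 ^ DIM('a) * (?v * (R / 2) ^ DIM('a))"
    by (simp add: power_mult_distrib power_divide)
  finally have "real (card S) \<le> 5 ^ DIM('a)"
    using R v by (simp add: mult_le_cancel_right)
  then show ?thesis by (metis of_nat_le_iff of_nat_numeral of_nat_power)
qed

text \<open>Consecutive points of the chain may be close, but those with even index are mutually
  separated, and so are those with odd index. The packing bound applies to each class, which
  explains the factor 2.\<close>

lemma sum_indicator_ball_chain_le:
  fixes p :: "nat \<Rightarrow> 'a::euclidean_space"
  assumes R: "R > 0" and sep: "\<And>i j. i + 2 \<le> j \<Longrightarrow> j \<le> m \<Longrightarrow> dist (p i) (p j) > R"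
  shows "(\<Sum>i\<le>m. indicator (ball (p i) (2 * R)) y) \<le> (2 * 5 ^ DIM('a) :: real)"
proof -
  define S where "S = {i. i \<le> m \<and> y \<in> ball (p i) (2 * R)}"
  have half: "card {i\<in>S. P i} \<le> 5 ^ DIM('a)" if P: "\<And>i. \<not> (P i \<and> P (Suc i))" for P
  proof (rule card_separated_le[OF _ R])
    fix i j assume ij: "i \<in> {i\<in>S. P i}" "j \<in> {i\<in>S. P i}" "i \<noteq> j"
    then have "j \<noteq> Suc i" "i \<noteq> Suc j" using P[of i] P[of j] by auto
    with \<open>i \<noteq> j\<close> have "i + 2 \<le> j \<or> j + 2 \<le> i" by linarith
    then show "R \<le> dist (p i) (p j)"
      using sep[of i j] sep[of j i] ij by (auto simp: S_def dist_commute)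
  qed (auto simp: S_def dist_commute)
  have "card S = card ({i\<in>S. even i} \<union> {i\<in>S. odd i})" by (rule arg_cong[of _ _ card]) auto
  also have "\<dots> \<le> card {i\<in>S. even i} + card {i\<in>S. odd i}" by (rule card_Un_le)
  also have "\<dots> \<le> 5 ^ DIM('a) + 5 ^ DIM('a)" by (intro add_mono half) auto
  finally have "card S \<le> 2 * 5 ^ DIM('a)" by simp
  moreover have "(\<Sum>i\<le>m. indicator (ball (p i) (2 * R)) y) = real (card S)"
    unfolding S_def indicator_def by (simp add: sum.If_cases Int_def)
  moreover have "real (card S) \<le> real (2 * 5 ^ DIM('a))"
    using calculation(1) by (rule of_nat_mono)
  ultimately show ?thesis by simp
qed

section \<open>The pointwise bound\<close>

text \<open>The change of the mean over one dyadic scale. Balls of the fixed radius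
  \<open>rad (T / 2)\<close> are first moved along the curve from \<open>\<gamma> (T / 2)\<close> to
  \<open>\<gamma> T\<close>, then the last one is enlarged to radius \<open>rad T\<close>. Bounded
  overlap makes the cost of the first stage independent of the number of balls. Taking half the John
  radius in \<open>rad\<close> leaves room for doubled balls.\<close>

lemma John_curve_level_estimate:
  fixes u :: "'a::euclidean_space \<Rightarrow> real" and \<gamma> :: "real \<Rightarrow> 'a"
  assumes d: "\<And>x. x \<in> \<Omega> \<Longrightarrow> (u has_derivative (\<lambda>h. g x \<bullet> h)) (at x)"
    and g: "continuous_on \<Omega> g" and op: "open \<Omega>" and u[measurable]: "u \<in> borel_measurable borel"
    and T: "0 < T" "T \<le> L" and c: "c > 0" and s: "s \<ge> 1"
    and ct: "\<And>t. 0 \<le> t \<Longrightarrow> t \<le> L \<Longrightarrow> c * t powr s \<le> t"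
    and lip: "\<And>a b. 0 \<le> a \<Longrightarrow> a \<le> b \<Longrightarrow> b \<le> L \<Longrightarrow> dist (\<gamma> a) (\<gamma> b) \<le> b - a"
    and sub: "\<And>t. t \<in> {0..L} \<Longrightarrow> ball (\<gamma> t) (c * t powr s) \<subseteq> \<Omega>"
  defines "rad \<equiv> \<lambda>t. c / 2 * t powr s"
  shows "(\<integral>\<^sup>+ z \<in> ball 0 1. ennreal \<bar>u (\<gamma> (T / 2) + rad (T / 2) *\<^sub>R z) - u (\<gamma> T + rad T *\<^sub>R z)\<bar> \<partial>lborel)
    \<le> ennreal ((2 * 5 ^ DIM('a) + 2 powr s) * (rad (T / 2) / rad (T / 2) ^ DIM('a))) *
       (\<integral>\<^sup>+ y \<in> ball (\<gamma> 0) (2 * T) \<inter> \<Omega>. ennreal (norm (g y)) \<partial>lborel)"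
proof -
  define R where "R = rad (T / 2)"
  define W where "W = ball (\<gamma> 0) (2 * T) \<inter> \<Omega>"
  have R: "R > 0" using T c by (simp add: R_def rad_def)
  have radT: "rad T = 2 powr s * R"
    using T by (simp add: R_def rad_def powr_divide)
  have one: "1 \<le> 2 powr s" using s by (simp add: ge_one_powr_ge_zero)
  have radT_ge: "R \<le> rad T" unfolding radT using R one by simp
  have [measurable]: "W \<in> sets borel" "\<Omega> \<in> sets borel" "ball y r \<in> sets borel" for y :: 'a and r
    using op by (auto simp: W_def)
  have WO: "W \<subseteq> \<Omega>" by (simp add: W_def)
  define G where "G = (\<lambda>y. ennreal (norm (indicator \<Omega> y *\<^sub>R g y)))"
  have [measurable]: "G \<in> borel_measurable borel"
    unfolding G_def using borel_measurable_continuous_on_indicator[OF _ g] by measurable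
  have G: "(\<integral>\<^sup>+ y \<in> V. ennreal (norm (g y)) \<partial>lborel) = (\<integral>\<^sup>+ y. G y * indicator V y \<partial>lborel)" if "V \<subseteq> \<Omega>" for V
    using that by (intro nn_integral_cong) (auto simp: G_def indicator_def)
  define I where "I = (\<integral>\<^sup>+ y \<in> W. ennreal (norm (g y)) \<partial>lborel)"
  have near: "dist (\<gamma> 0) (\<gamma> t) \<le> T" if "t \<in> {T/2..T}" for t
    using lip[of 0 t] that T by auto

  \<comment> \<open>Enough equal time steps on \<open>{T/2..T}\<close> that each has length at most
    \<open>R\<close>; the curve is 1-Lipschitz, so the sampled points form a chain with steps at
    most \<open>R\<close>.\<close>
  define m0 where "m0 = nat \<lceil>T / (2 * R)\<rceil>"
  have m0: "m0 > 0" "T / (2 * R) \<le> m0"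
    using T R by (auto simp: m0_def real_nat_ceiling_ge)
  define p0 where "p0 = (\<lambda>i. \<gamma> (T / 2 + real i * (T / (2 * m0))))"
  have tm: "T / 2 + real i * (T / (2 * m0)) \<in> {T/2..T}" if "i \<le> m0" for i
  proof -
    have "real i * (T / (2 * m0)) \<le> real m0 * (T / (2 * m0))"
      using that T by (intro mult_right_mono) auto
    moreover have "real m0 * (T / (2 * m0)) = T / 2" using m0 by simp
    ultimately show ?thesis using T by simp
  qed
  have p0_step: "dist (p0 i) (p0 (Suc i)) \<le> R" if "i < m0" for i
  proof -
    have "dist (p0 i) (p0 (Suc i)) \<le>
      (T / 2 + real (Suc i) * (T / (2 * m0))) - (T / 2 + real i * (T / (2 * m0)))"
      unfolding p0_def using tm[of i] tm[of "Suc i"] that T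
      by (intro lip) (auto intro!: divide_right_mono mult_right_mono)
    also have "\<dots> = T / (2 * m0)" by (simp add: algebra_simps add_divide_distrib)
    also have "\<dots> \<le> R" using m0 R by (simp add: field_simps)
    finally show ?thesis .
  qed
  have p0_in: "p0 i \<in> \<gamma> ` {T/2..T}" if "i \<le> m0" for i
    using tm[OF that] by (auto simp: p0_def)
  obtain m p where p: "p 0 = p0 0" "p m = p0 m0" "\<And>i. i \<le> m \<Longrightarrow> p i \<in> \<gamma> ` {T/2..T}"
    "\<And>i. i < m \<Longrightarrow> dist (p i) (p (Suc i)) \<le> R"
    "\<And>i j. i + 2 \<le> j \<Longrightarrow> j \<le> m \<Longrightarrow> dist (p i) (p j) > R"
  proof (rule minimal_chain[of m0 p0 "\<gamma> ` {T/2..T}" R], goal_cases)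
    case (3 m p)
    show ?case by (rule 3(1)[OF 3(2-)])
  qed (use p0_in p0_step in auto)
  have ends: "p 0 = \<gamma> (T / 2)" "p m = \<gamma> T"
    using p(1,2) m0 by (auto simp: p0_def)
  \<comment> \<open>Since \<open>2 * R = c * (T / 2) powr s\<close> and
    \<open>t \<ge> T / 2\<close>, the doubled ball fits into the John ball at
    \<open>\<gamma> t\<close>; \<open>ct\<close> at \<open>T / 2\<close> bounds \<open>2 * R\<close>
    by \<open>T\<close>, which together with \<open>near\<close> gives the inclusion in the ball of
    radius \<open>2 * T\<close>.\<close>
  have ballW: "ball (p i) (2 * R) \<subseteq> W" if i: "i \<le> m" for i
  proof -
    obtain t where t: "t \<in> {T/2..T}" "p i = \<gamma> t" using p(3)[OF i] by auto
    have "2 * R \<le> c * t powr s"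
      using c t T s by (auto simp: R_def rad_def intro!: powr_mono2)
    then have 1: "ball (p i) (2 * R) \<subseteq> \<Omega>"
      using sub[of t] t T subset_ball[of "2 * R" "c * t powr s" "p i"] by auto
    have "2 * R \<le> T"
      using ct[of "T/2"] T by (simp add: R_def rad_def)
    then have "ball (p i) (2 * R) \<subseteq> ball (\<gamma> 0) (2 * T)"
      using near[OF t(1)] unfolding t(2)
      by (simp add: ball_subset_ball_iff dist_commute)
    with 1 show ?thesis by (simp add: W_def)
  qed

  have step: "(\<integral>\<^sup>+ z \<in> ball 0 1. ennreal \<bar>u (p (Suc i) + R *\<^sub>R z) - u (p i + R *\<^sub>R z)\<bar> \<partial>lborel)
     \<le> ennreal (R / R ^ DIM('a)) * (\<integral>\<^sup>+ y. G y * indicator (ball (p i) (2 * R)) y \<partial>lborel)"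
    if i: "i < m" for i
  proof -
    have BO: "ball (p i) (2 * R) \<subseteq> \<Omega>" using ballW[of i] WO i by auto
    \<comment> \<open>A ball of radius \<open>R\<close> moving from \<open>p i\<close> to the next
      point is displaced by at most \<open>R\<close>, so the doubled ball around \<open>p i\<close>
      contains its whole path.\<close>
    have "ball (p i + \<tau> *\<^sub>R (p (Suc i) - p i)) (R + \<tau> * (R - R)) \<subseteq> ball (p i) (2 * R)"
      if "\<tau> \<in> {0..1}" for \<tau> :: real
    proof -
      have "\<tau> * dist (p i) (p (Suc i)) \<le> 1 * R"
        using that p(4)[OF i] R by (intro mult_mono) auto
      then show ?thesis using that
        by (simp add: ball_subset_ball_iff dist_norm norm_minus_commute)
    qed
    from nn_integral_ball_abs_diff_le[OF d g _ BO this R order_refl order_refl, of R]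
    show ?thesis using p(4)[OF i] by (simp add: G[OF BO])
  qed

  have A: "(\<integral>\<^sup>+ z \<in> ball 0 1. ennreal \<bar>u (p m + R *\<^sub>R z) - u (p 0 + R *\<^sub>R z)\<bar> \<partial>lborel)
      \<le> ennreal (2 * 5 ^ DIM('a) * (R / R ^ DIM('a))) * I"
  proof -
    have "(\<integral>\<^sup>+ z \<in> ball 0 1. ennreal \<bar>u (p m + R *\<^sub>R z) - u (p 0 + R *\<^sub>R z)\<bar> \<partial>lborel)
       \<le> (\<integral>\<^sup>+ z. (\<Sum>i<m. ennreal \<bar>u (p (Suc i) + R *\<^sub>R z) - u (p i + R *\<^sub>R z)\<bar> * indicator (ball 0 1) z) \<partial>lborel)"
    proof (rule nn_integral_mono, goal_cases)
      case (1 z)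
      have "\<bar>u (p m + R *\<^sub>R z) - u (p 0 + R *\<^sub>R z)\<bar> = \<bar>\<Sum>i<m. u (p (Suc i) + R *\<^sub>R z) - u (p i + R *\<^sub>R z)\<bar>"
        using sum_lessThan_telescope[of "\<lambda>i. u (p i + R *\<^sub>R z)" m] by simp
      also have "\<dots> \<le> (\<Sum>i<m. \<bar>u (p (Suc i) + R *\<^sub>R z) - u (p i + R *\<^sub>R z)\<bar>)" by (rule sum_abs)
      finally have "ennreal \<bar>u (p m + R *\<^sub>R z) - u (p 0 + R *\<^sub>R z)\<bar> \<le> (\<Sum>i<m. ennreal \<bar>u (p (Suc i) + R *\<^sub>R z) - u (p i + R *\<^sub>R z)\<bar>)"
        by (subst sum_ennreal) (auto intro: ennreal_leI)
      then show ?case unfolding sum_distrib_right[symmetric] by (rule mult_right_mono) simp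
    qed
    also have "\<dots> = (\<Sum>i<m. \<integral>\<^sup>+ z \<in> ball 0 1. ennreal \<bar>u (p (Suc i) + R *\<^sub>R z) - u (p i + R *\<^sub>R z)\<bar> \<partial>lborel)"
      by (rule nn_integral_sum) measurable
    also have "\<dots> \<le> (\<Sum>i<m. ennreal (R / R ^ DIM('a)) * (\<integral>\<^sup>+ y. G y * indicator (ball (p i) (2 * R)) y \<partial>lborel))"
      by (intro sum_mono step) simp
    also have "\<dots> = ennreal (R / R ^ DIM('a)) * (\<integral>\<^sup>+ y. (\<Sum>i<m. G y * indicator (ball (p i) (2 * R)) y) \<partial>lborel)"
      by (subst nn_integral_sum) (measurable, simp add: sum_distrib_left)
    \<comment> \<open>The overlap bound enters here: at each point the sum over the chain is at most
      \<open>2 * 5 ^ DIM('a)\<close> copies of \<open>G\<close>, and it vanishes off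
      \<open>W\<close>.\<close>
    also have "(\<integral>\<^sup>+ y. (\<Sum>i<m. G y * indicator (ball (p i) (2 * R)) y) \<partial>lborel) \<le>
       (\<integral>\<^sup>+ y. ennreal (2 * 5 ^ DIM('a)) * (G y * indicator W y) \<partial>lborel)"
    proof (rule nn_integral_mono, goal_cases)
      case (1 y)
      show ?case
      proof (cases "y \<in> W")
        case True
        have "(\<Sum>i<m. indicator (ball (p i) (2 * R)) y) \<le> (\<Sum>i\<le>m. indicator (ball (p i) (2 * R)) y :: real)"
          by (rule sum_mono2) auto
        also have "\<dots> \<le> 2 * 5 ^ DIM('a)" by (rule sum_indicator_ball_chain_le[OF R p(5)])
        finally have "ennreal (\<Sum>i<m. indicator (ball (p i) (2 * R)) y) \<le> ennreal (2 * 5 ^ DIM('a))"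
          by (rule ennreal_leI)
        then have "(\<Sum>i<m. indicator (ball (p i) (2 * R)) y) \<le> ennreal (2 * 5 ^ DIM('a))"
          by (subst (asm) sum_ennreal[symmetric]) (simp_all add: ennreal_indicator)
        then have "G y * (\<Sum>i<m. indicator (ball (p i) (2 * R)) y) \<le> G y * ennreal (2 * 5 ^ DIM('a))"
          by (rule mult_left_mono) simp
        then show ?thesis using True by (simp add: sum_distrib_left mult.commute)
      next
        case False
        then have "y \<notin> ball (p i) (2 * R)" if "i < m" for i using ballW[of i] that by auto
        then have "(\<Sum>i<m. G y * indicator (ball (p i) (2 * R)) y) = 0"
          by (intro sum.neutral ballI) (simp add: indicator_simps(2) del: mem_ball)
        then show ?thesis by (simp only: zero_le)
      qed
    qed
    also have "\<dots> = ennreal (2 * 5 ^ DIM('a)) * I"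
      unfolding I_def G[OF WO] by (rule nn_integral_cmult) measurable
    finally have "(\<integral>\<^sup>+ z \<in> ball 0 1. ennreal \<bar>u (p m + R *\<^sub>R z) - u (p 0 + R *\<^sub>R z)\<bar> \<partial>lborel)
        \<le> ennreal (R / R ^ DIM('a)) * (ennreal (2 * 5 ^ DIM('a)) * I)"
      by (simp add: mult_left_mono)
    also have "\<dots> = ennreal (2 * 5 ^ DIM('a) * (R / R ^ DIM('a))) * I"
      using R by (subst ennreal_mult[of "2 * 5 ^ DIM('a)" "R / R ^ DIM('a)"]) (simp_all add: mult_ac)
    finally show ?thesis .
  qed

  \<comment> \<open>The centre stays at \<open>\<gamma> T\<close> and only the radius grows, from
    \<open>R\<close> to \<open>2 powr s * R\<close>, so a point travels at most
    \<open>2 powr s * R\<close>.\<close>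
  have B: "(\<integral>\<^sup>+ z \<in> ball 0 1. ennreal \<bar>u (\<gamma> T + rad T *\<^sub>R z) - u (\<gamma> T + R *\<^sub>R z)\<bar> \<partial>lborel)
      \<le> ennreal (2 powr s * (R / R ^ DIM('a))) * I"
  proof -
    have sT: "ball (\<gamma> T) (rad T) \<subseteq> W"
    proof -
      have "rad T \<le> c * T powr s" using c by (simp add: rad_def)
      then have "ball (\<gamma> T) (rad T) \<subseteq> \<Omega>"
        using sub[of T] T subset_ball[of "rad T" "c * T powr s" "\<gamma> T"] by auto
      moreover have "rad T \<le> T" using ct[of T] T c by (simp add: rad_def)
      then have "ball (\<gamma> T) (rad T) \<subseteq> ball (\<gamma> 0) (2 * T)"
        using near[of T] T by (simp add: ball_subset_ball_iff dist_commute)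
      ultimately show ?thesis by (simp add: W_def)
    qed
    have "ball (\<gamma> T + \<tau> *\<^sub>R (\<gamma> T - \<gamma> T)) (R + \<tau> * (rad T - R)) \<subseteq> W" if "\<tau> \<in> {0..1}" for \<tau>
    proof -
      have "\<tau> * (rad T - R) \<le> 1 * (rad T - R)"
        using that radT_ge by (intro mult_right_mono) auto
      then have "ball (\<gamma> T) (R + \<tau> * (rad T - R)) \<subseteq> ball (\<gamma> T) (rad T)" by (intro subset_ball) simp
      then show ?thesis using sT by simp
    qed
    from nn_integral_ball_abs_diff_le[OF d g _ WO this R order_refl radT_ge, of "2 powr s * R"]
    show ?thesis using R radT_ge by (simp add: I_def radT)
  qed

  have "(\<integral>\<^sup>+ z \<in> ball 0 1. ennreal \<bar>u (\<gamma> (T / 2) + R *\<^sub>R z) - u (\<gamma> T + rad T *\<^sub>R z)\<bar> \<partial>lborel)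
     \<le> (\<integral>\<^sup>+ z. ennreal \<bar>u (p m + R *\<^sub>R z) - u (p 0 + R *\<^sub>R z)\<bar> * indicator (ball 0 1) z
           + ennreal \<bar>u (\<gamma> T + rad T *\<^sub>R z) - u (\<gamma> T + R *\<^sub>R z)\<bar> * indicator (ball 0 1) z \<partial>lborel)"
    unfolding ends
    by (intro nn_integral_mono) (auto simp: indicator_def ennreal_plus[symmetric] simp del: ennreal_plus intro!: ennreal_leI)
  also have "\<dots> = (\<integral>\<^sup>+ z \<in> ball 0 1. ennreal \<bar>u (p m + R *\<^sub>R z) - u (p 0 + R *\<^sub>R z)\<bar> \<partial>lborel)
     + (\<integral>\<^sup>+ z \<in> ball 0 1. ennreal \<bar>u (\<gamma> T + rad T *\<^sub>R z) - u (\<gamma> T + R *\<^sub>R z)\<bar> \<partial>lborel)"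
    by (rule nn_integral_add) measurable
  also have "\<dots> \<le> ennreal (2 * 5 ^ DIM('a) * (R / R ^ DIM('a))) * I + ennreal (2 powr s * (R / R ^ DIM('a))) * I"
    by (intro add_mono A B)
  also have "\<dots> = ennreal ((2 * 5 ^ DIM('a) + 2 powr s) * (R / R ^ DIM('a))) * I"
    using R unfolding distrib_right[of _ _ "R / R ^ DIM('a)"]
    by (subst ennreal_plus) (simp_all add: distrib_right)
  finally show ?thesis unfolding I_def W_def R_def .
qed


text \<open>Telescoping and passage to the limit. In \<open>ennreal\<close> the right-hand side is
  meaningful whether or not the series converges.\<close>

lemma abs_lim_diff_le_suminf:
  fixes w :: "nat \<Rightarrow> real"
  assumes "w \<longlonglongrightarrow> l"
  shows "ennreal \<bar>l - w 0\<bar> \<le> (\<Sum>k. ennreal \<bar>w (Suc k) - w k\<bar>)"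
proof (rule LIMSEQ_le_const2)
  show "(\<lambda>n. ennreal \<bar>w n - w 0\<bar>) \<longlonglongrightarrow> ennreal \<bar>l - w 0\<bar>"
    using assms by (intro tendsto_intros)
  have "ennreal \<bar>w n - w 0\<bar> \<le> (\<Sum>k. ennreal \<bar>w (Suc k) - w k\<bar>)" for n
  proof -
    have "\<bar>w n - w 0\<bar> \<le> (\<Sum>k<n. \<bar>w (Suc k) - w k\<bar>)"
      using sum_abs[of "\<lambda>k. w (Suc k) - w k" "{..<n}"] sum_lessThan_telescope[of w n] by simp
    then have "ennreal \<bar>w n - w 0\<bar> \<le> (\<Sum>k<n. ennreal \<bar>w (Suc k) - w k\<bar>)"
      by (subst sum_ennreal) (auto intro: ennreal_leI)
    also have "\<dots> \<le> (\<Sum>k. ennreal \<bar>w (Suc k) - w k\<bar>)"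
      by (rule sum_le_suminf) auto
    finally show ?thesis .
  qed
  then show "\<exists>N. \<forall>n\<ge>N. ennreal \<bar>w n - w 0\<bar> \<le> (\<Sum>k. ennreal \<bar>w (Suc k) - w k\<bar>)" by blast
qed

text \<open>Contrapositively, \<open>\<bar>u - b\<bar>\<close> is bounded by a constant times the maximal function of the gradient.\<close>

lemma s_John_domain_pointwise:
  fixes \<Omega> :: "'a::euclidean_space set"
  assumes J: "s_John_domain s \<Omega>" and dim: "DIM('a) \<ge> 2" and s: "s < real DIM('a) / (real DIM('a) - 1)"
  obtains C \<rho> where "C > 0" "\<rho> > 0"
    "\<And>(u :: 'a \<Rightarrow> real) g. (\<And>x. x \<in> \<Omega> \<Longrightarrow> (u has_derivative (\<lambda>h. g x \<bullet> h)) (at x)) \<Longrightarrow>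
       continuous_on \<Omega> g \<Longrightarrow> u \<in> borel_measurable borel \<Longrightarrow>
       \<exists>b. \<forall>x\<in>\<Omega>. \<forall>t\<ge>0.
         (\<forall>r\<in>{0<..\<rho>}. (\<integral>\<^sup>+ y \<in> ball x r \<inter> \<Omega>. ennreal (norm (g y)) \<partial>lborel) \<le> ennreal (t * r ^ DIM('a)))
           \<longrightarrow> \<bar>u x - b\<bar> \<le> C * t"
proof -
  let ?n = "DIM('a)"
  have s1: "s \<ge> 1" and op: "open \<Omega>" using J by (auto simp: s_John_domain_def)
  obtain c L x0 where c: "c > 0" and L: "L > 0" and x0: "x0 \<in> \<Omega>"
    and ct: "\<And>t. 0 \<le> t \<Longrightarrow> t \<le> L \<Longrightarrow> c * t powr s \<le> t"
    and curves: "\<And>x. x \<in> \<Omega> \<Longrightarrow> \<exists>\<gamma>. \<gamma> 0 = x \<and> \<gamma> L = x0 \<and>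
        (\<forall>a b. 0 \<le> a \<longrightarrow> a \<le> b \<longrightarrow> b \<le> L \<longrightarrow> dist (\<gamma> a) (\<gamma> b) \<le> b - a) \<and>
        (\<forall>t\<in>{0..L}. ball (\<gamma> t) (c * t powr s) \<subseteq> \<Omega>)"
    using s_John_domain_curves[OF J] by metis
  define rad where "rad = (\<lambda>t. c / 2 * t powr s)"
  \<comment> \<open>The factor \<open>T powr (s * (1 - n))\<close> from the radii and
    \<open>T powr n\<close> from the ball of radius \<open>2 * T\<close>, with
    \<open>n = DIM('a)\<close>, combine to \<open>T powr \<alpha>\<close>. Positivity of \<alpha> is
    exactly the condition \<open>s < n / (n - 1)\<close>.\<close>
  define \<alpha> where "\<alpha> = real ?n - s * (real ?n - 1)"
  have \<alpha>: "\<alpha> > 0" using s dim by (simp add: \<alpha>_def field_simps)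
  \<comment> \<open>Chosen so that \<open>rad (T / 2) = c' * T powr s\<close>.\<close>
  define c' where "c' = c / 2 / 2 powr s"
  have c': "c' > 0" using c by (simp add: c'_def)
  define A where "A = (2 * 5 ^ ?n + 2 powr s) * 2 ^ ?n * c' powr (1 - real ?n)"
  have A: "A > 0" using c' by (auto simp: A_def intro!: mult_pos_pos add_pos_pos)
  have powers: "(2 * 5 ^ ?n + 2 powr s) * (rad (T / 2) / rad (T / 2) ^ ?n) * (2 * T) ^ ?n = A * T powr \<alpha>"
    if T: "T > 0" for T
  proof -
    have r: "rad (T / 2) = c' * T powr s" using T by (simp add: rad_def c'_def powr_divide)
    have pos: "c' * T powr s > 0" using c' T by simp
    have "rad (T / 2) / rad (T / 2) ^ ?n = (c' * T powr s) powr (1 - real ?n)"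
      unfolding r using pos by (simp add: powr_diff powr_realpow)
    also have "\<dots> = c' powr (1 - real ?n) * T powr (s * (1 - real ?n))"
      using c' T by (simp add: powr_mult powr_powr)
    finally have 1: "rad (T / 2) / rad (T / 2) ^ ?n = c' powr (1 - real ?n) * T powr (s * (1 - real ?n))" .
    have 2: "(2 * T) ^ ?n = 2 ^ ?n * T powr (real ?n)" using T by (simp add: power_mult_distrib powr_realpow)
    have "T powr (s * (1 - real ?n)) * T powr (real ?n) = T powr \<alpha>"
      unfolding powr_add[symmetric] \<alpha>_def by (simp add: algebra_simps)
    then show ?thesis unfolding 1 2 A_def by (simp add: mult_ac)
  qed
  \<comment> \<open>The ratio of the bounds at consecutive scales: halving \<open>T\<close>
    multiplies \<open>T powr \<alpha>\<close> by \<open>q\<close>.\<close>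
  define q where "q = (1/2::real) powr \<alpha>"
  have q: "0 < q" "q < 1" using \<alpha> powr_less_mono2[of \<alpha> "1/2" 1] by (auto simp: q_def)
  define S where "S = A * L powr \<alpha> * (1 / (1 - q))"
  have S: "S > 0" using A L q by (simp add: S_def)
  define v where "v = measure lborel (ball (0::'a) 1)"
  have v: "v > 0" unfolding v_def using content_ball_pos[of 1 "0::'a"] by simp
  have vb: "emeasure lborel (ball (0::'a) 1) = ennreal v"
    unfolding v_def by (rule emeasure_eq_ennreal_measure) (use emeasure_lborel_ball_finite[of "0::'a" 1] in auto)
  show thesis
  \<comment> \<open>\<open>S\<close> sums the geometric series of all scales, and division by
    \<open>v\<close> turns the integral over the unit ball into a mean. The largest ball around
    \<open>x\<close> that occurs belongs to the scale \<open>L\<close> and has radius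
    \<open>2 * L\<close>.\<close>
  proof (rule that[of "S / v" "2 * L"])
    show "S / v > 0" "2 * L > 0" using S v L by auto
    fix u :: "'a \<Rightarrow> real" and g
    assume d: "\<And>x. x \<in> \<Omega> \<Longrightarrow> (u has_derivative (\<lambda>h. g x \<bullet> h)) (at x)"
      and g: "continuous_on \<Omega> g" and u[measurable]: "u \<in> borel_measurable borel"
    have cu: "continuous_on \<Omega> u"
      using d has_derivative_continuous by (intro continuous_at_imp_continuous_on) blast
    define w where "w = (\<lambda>z. u (x0 + rad L *\<^sub>R z))"
    have w[measurable]: "w \<in> borel_measurable borel" unfolding w_def by measurable
    have [measurable]: "ball (0::'a) 1 \<in> sets borel" by simp
    \<comment> \<open>The function \<open>u\<close> may be unbounded near the boundary, but
      \<open>rad L\<close> is only half the John radius at \<open>x0\<close>, so the closed ball of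
      radius \<open>rad L\<close> is a compact subset of \<Omega>.\<close>
    have wint: "set_integrable lborel (ball 0 1) w"
    proof (rule set_integrable_subset)
      have rL: "rad L < c * L powr s" "rad L \<ge> 0" using c L by (auto simp: rad_def)
      have "x0 + rad L *\<^sub>R z \<in> \<Omega>" if "norm z \<le> 1" for z
      proof -
        have "rad L * norm z \<le> rad L * 1" using that rL by (intro mult_left_mono) auto
        then have "x0 + rad L *\<^sub>R z \<in> ball x0 (c * L powr s)" using rL by (simp add: dist_norm)
        moreover obtain \<gamma> where "\<gamma> L = x0" "\<forall>t\<in>{0..L}. ball (\<gamma> t) (c * t powr s) \<subseteq> \<Omega>"
          using curves[OF x0] by blast
        then have "ball x0 (c * L powr s) \<subseteq> \<Omega>" using L by (metis atLeastAtMost_iff less_imp_le order_refl)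
        ultimately show ?thesis by blast
      qed
      then have "continuous_on (cball 0 1) w"
        unfolding w_def by (intro continuous_on_compose2[OF cu]) (auto intro!: continuous_intros)
      then show "set_integrable lborel (cball 0 1) w"
        unfolding set_integrable_def by (intro borel_integrable_compact) auto
    qed auto
    \<comment> \<open>The mean of \<open>u\<close> over the ball of radius \<open>rad L\<close>
      around \<open>x0\<close>. It does not depend on \<open>x\<close>, since all continued curves
      reach \<open>x0\<close> at the common time \<open>L\<close>.\<close>
    define b where "b = (LINT z:ball 0 1|lborel. w z) / v"
    have "\<bar>u x - b\<bar> \<le> S / v * t"
      if x: "x \<in> \<Omega>" and t: "t \<ge> 0"
        and max: "\<And>r. r \<in> {0<..2 * L} \<Longrightarrow> (\<integral>\<^sup>+ y \<in> ball x r \<inter> \<Omega>. ennreal (norm (g y)) \<partial>lborel) \<le> ennreal (t * r ^ ?n)"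
      for x t
    proof -
      obtain \<gamma> where \<gamma>: "\<gamma> 0 = x" "\<gamma> L = x0"
        and lip: "\<And>a b. 0 \<le> a \<Longrightarrow> a \<le> b \<Longrightarrow> b \<le> L \<Longrightarrow> dist (\<gamma> a) (\<gamma> b) \<le> b - a"
        and sub: "\<And>t. t \<in> {0..L} \<Longrightarrow> ball (\<gamma> t) (c * t powr s) \<subseteq> \<Omega>"
        using curves[OF x] by blast
      define T where "T = (\<lambda>k::nat. L * (1/2) ^ k)"
      have T: "0 < T k" "T k \<le> L" "T (Suc k) = T k / 2" for k
        using L by (auto simp: T_def power_le_one mult_le_cancel_left1)
      have T0: "T \<longlonglongrightarrow> 0" unfolding T_def by real_asymp
      define W where "W = (\<lambda>k z. u (\<gamma> (T k) + rad (T k) *\<^sub>R z))"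
      have [measurable]: "W k \<in> borel_measurable borel" for k unfolding W_def by measurable
      have level: "(\<integral>\<^sup>+ z \<in> ball 0 1. ennreal \<bar>W (Suc k) z - W k z\<bar> \<partial>lborel) \<le> ennreal (A * L powr \<alpha> * t * q ^ k)" for k
      proof -
        have "(\<integral>\<^sup>+ z \<in> ball 0 1. ennreal \<bar>W (Suc k) z - W k z\<bar> \<partial>lborel)
          \<le> ennreal ((2 * 5 ^ ?n + 2 powr s) * (rad (T k / 2) / rad (T k / 2) ^ ?n)) *
             (\<integral>\<^sup>+ y \<in> ball (\<gamma> 0) (2 * T k) \<inter> \<Omega>. ennreal (norm (g y)) \<partial>lborel)"
          unfolding W_def T(3) rad_def
          by (rule John_curve_level_estimate[OF d g op u T(1,2) c s1 ct lip sub])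
        also have "\<dots> \<le> ennreal ((2 * 5 ^ ?n + 2 powr s) * (rad (T k / 2) / rad (T k / 2) ^ ?n)) * ennreal (t * (2 * T k) ^ ?n)"
          using max[of "2 * T k"] T[of k] \<gamma> by (intro mult_left_mono) auto
        also have "\<dots> = ennreal ((2 * 5 ^ ?n + 2 powr s) * (rad (T k / 2) / rad (T k / 2) ^ ?n) * (2 * T k) ^ ?n * t)"
          using t T(1)[of k] by (subst ennreal_mult''[symmetric]) (simp_all add: mult_ac)
        also have "\<dots> = ennreal (A * T k powr \<alpha> * t)"
          by (simp only: powers[OF T(1)])
        also have "T k powr \<alpha> = L powr \<alpha> * q ^ k"
        proof -
          have "T k powr \<alpha> = L powr \<alpha> * ((1/2) ^ k) powr \<alpha>"
            unfolding T_def by (rule powr_mult)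
          also have "((1/2::real) ^ k) powr \<alpha> = q ^ k"
            unfolding q_def by (simp add: powr_realpow[symmetric] powr_powr mult.commute)
          finally show ?thesis .
        qed
        also have "A * (L powr \<alpha> * q ^ k) * t = A * L powr \<alpha> * t * q ^ k" by simp
        finally show ?thesis .
      qed
      \<comment> \<open>The shrinking balls converge to the point \<open>x\<close>, where
        \<open>u\<close> is continuous; this identifies the limit of the telescoping series for
        every fixed \<open>z\<close>.\<close>
      have lim: "(\<lambda>k. W k z) \<longlonglongrightarrow> u x" for z
      proof -
        have "(\<lambda>k. \<gamma> (T k)) \<longlonglongrightarrow> x"
        proof (rule Lim_null_comparison[THEN LIM_zero_cancel])
          show "\<forall>\<^sub>F k in sequentially. norm (\<gamma> (T k) - x) \<le> T k"
            using lip[of 0 "T _"] T(1,2) \<gamma> by (auto simp: dist_norm norm_minus_commute less_imp_le)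
        qed (rule T0)
        moreover have "(\<lambda>k. rad (T k)) \<longlonglongrightarrow> 0"
        proof -
          have "(\<lambda>k. T k powr s) \<longlonglongrightarrow> 0 powr s"
            using T0 s1 less_imp_le[OF T(1)] by (intro tendsto_powr') auto
          then show ?thesis unfolding rad_def using s1 by (auto intro!: tendsto_mult_right_zero)
        qed
        ultimately have "(\<lambda>k. \<gamma> (T k) + rad (T k) *\<^sub>R z) \<longlonglongrightarrow> x + 0 *\<^sub>R z" by (intro tendsto_intros)
        moreover have "isCont u x" using d[OF x] has_derivative_continuous by blast
        ultimately show ?thesis unfolding W_def by (intro isCont_tendsto_compose[of x u]) simp_all
      qed
      have "(\<integral>\<^sup>+ z \<in> ball 0 1. ennreal \<bar>u x - w z\<bar> \<partial>lborel)
         \<le> (\<integral>\<^sup>+ z. (\<Sum>k. ennreal \<bar>W (Suc k) z - W k z\<bar> * indicator (ball 0 1) z) \<partial>lborel)"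
      proof (rule nn_integral_mono, goal_cases)
        case (1 z)
        have "W 0 z = w z" by (simp add: W_def T_def \<gamma> w_def)
        then have "ennreal \<bar>u x - w z\<bar> \<le> (\<Sum>k. ennreal \<bar>W (Suc k) z - W k z\<bar>)"
          using abs_lim_diff_le_suminf[OF lim[of z]] by simp
        then show ?case by (simp add: mult_right_mono ennreal_suminf_multc)
      qed
      also have "\<dots> = (\<Sum>k. \<integral>\<^sup>+ z \<in> ball 0 1. ennreal \<bar>W (Suc k) z - W k z\<bar> \<partial>lborel)"
        by (rule nn_integral_suminf) measurable
      also have "\<dots> \<le> (\<Sum>k. ennreal (A * L powr \<alpha> * t * q ^ k))"
        by (intro suminf_le level) auto
      also have "\<dots> = ennreal (S * t)"
      proof (rule suminf_ennreal_eq)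
        have "(\<lambda>k. q ^ k) sums (1 / (1 - q))" using q by (intro geometric_sums) auto
        from sums_mult[OF this, of "A * L powr \<alpha> * t"]
        show "(\<lambda>k. A * L powr \<alpha> * t * q ^ k) sums (S * t)" by (simp add: S_def mult_ac)
      qed (use A t q in auto)
      finally have main: "(\<integral>\<^sup>+ z \<in> ball 0 1. ennreal \<bar>u x - w z\<bar> \<partial>lborel) \<le> ennreal (S * t)" .
      have cint: "set_integrable lborel (ball (0::'a) 1) (\<lambda>z. u x)"
        unfolding set_integrable_def using vb by (simp add: integrable_mult_right_iff)
      have "(LINT z:ball 0 1|lborel. u x - w z) = v * (u x - b)"
        using v by (simp add: set_integral_diff[OF cint wint] b_def field_simps)
          (simp add: set_lebesgue_integral_def v_def)
      then have "ennreal (v * \<bar>u x - b\<bar>) = ennreal (norm (LINT z:ball 0 1|lborel. u x - w z))"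
        using v by (simp add: abs_mult)
      also have "\<dots> \<le> (\<integral>\<^sup>+ z. norm (indicator (ball 0 1) z *\<^sub>R (u x - w z)) \<partial>lborel)"
        unfolding set_lebesgue_integral_def
        using set_integral_diff(1)[OF cint wint] by (intro integral_norm_bound_ennreal) (simp add: set_integrable_def)
      also have "\<dots> = (\<integral>\<^sup>+ z \<in> ball 0 1. ennreal \<bar>u x - w z\<bar> \<partial>lborel)"
        by (intro nn_integral_cong) (auto simp: indicator_def)
      also have "\<dots> \<le> ennreal (S * t)" by (rule main)
      finally have "v * \<bar>u x - b\<bar> \<le> S * t" using S t by (simp add: ennreal_le_iff)
      then show ?thesis using v by (simp add: field_simps)
    qed
    then show "\<exists>b. \<forall>x\<in>\<Omega>. \<forall>t\<ge>0.
         (\<forall>r\<in>{0<..2 * L}. (\<integral>\<^sup>+ y \<in> ball x r \<inter> \<Omega>. ennreal (norm (g y)) \<partial>lborel) \<le> ennreal (t * r ^ ?n))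
           \<longrightarrow> \<bar>u x - b\<bar> \<le> S / v * t"
      by (intro exI[of _ b]) blast
  qed
qed

section \<open>Hausdorff content and the maximal inequality\<close>

text \<open>Allows covers indexed by any countable set. Natural numbers outside the image of the
  enumeration get radius 0: an empty ball that contributes
  \<open>0 powr \<beta> = 0\<close>.\<close>

lemma hausdorff_content_le_nn_integral_count_space:
  fixes c :: "'i \<Rightarrow> 'a::euclidean_space"
  assumes I: "countable I" and cov: "E \<subseteq> (\<Union>i\<in>I. ball (c i) (r i))" and r: "\<And>i. i \<in> I \<Longrightarrow> r i \<ge> 0"
  shows "hausdorff_content \<beta> E \<le> (\<integral>\<^sup>+ i. ennreal (r i powr \<beta>) \<partial>count_space I)"
proof -
  let ?f = "to_nat_on I" and ?g = "from_nat_into I"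
  have bij: "bij_betw ?f I (?f ` I)" using I by (simp add: inj_on_to_nat_on inj_on_imp_bij_betw)
  have gf: "?g (?f i) = i" if "i \<in> I" for i using I that by simp
  define r' where "r' = (\<lambda>k. if k \<in> ?f ` I then r (?g k) else 0)"
  have "hausdorff_content \<beta> E \<le> (\<Sum>k. ennreal (r' k powr \<beta>))"
    unfolding hausdorff_content_def
  proof (rule INF_lower2[where i="(\<lambda>k. c (?g k), r')"], safe)
    fix k show "0 \<le> r' k" using r gf by (auto simp: r'_def)
  next
    fix y assume "y \<in> E"
    then obtain i where i: "i \<in> I" "y \<in> ball (c i) (r i)" using cov by blast
    then have "y \<in> ball (c (?g (?f i))) (r' (?f i))" using gf by (simp add: r'_def)
    then show "y \<in> (\<Union>k. ball (c (?g k)) (r' k))" by blast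
  qed
  also have "\<dots> = (\<integral>\<^sup>+ k. ennreal (r' k powr \<beta>) \<partial>count_space UNIV)"
    by (simp add: nn_integral_count_space_nat)
  also have "\<dots> = (\<integral>\<^sup>+ k. ennreal (r (?g k) powr \<beta>) * indicator (?f ` I) k \<partial>count_space UNIV)"
    by (intro nn_integral_cong) (simp add: r'_def)
  also have "\<dots> = (\<integral>\<^sup>+ k. ennreal (r (?g k) powr \<beta>) \<partial>count_space (?f ` I))"
    by (subst (2) nn_integral_count_space_indicator) auto
  also have "\<dots> = (\<integral>\<^sup>+ i. ennreal (r (?g (?f i)) powr \<beta>) \<partial>count_space I)"
    by (rule nn_integral_bij_count_space[OF bij, symmetric])
  also have "\<dots> = (\<integral>\<^sup>+ i. ennreal (r i powr \<beta>) \<partial>count_space I)"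
    by (intro nn_integral_cong) (simp add: gf)
  finally show ?thesis .
qed

text \<open>Two covers with different index types are merged over the sum type, as needed for
  dilated balls of a given family together with Vitali balls indexed by their centres.\<close>

lemma hausdorff_content_le_two_covers:
  fixes c :: "'i \<Rightarrow> 'a::euclidean_space" and c' :: "'j \<Rightarrow> 'a"
  assumes I: "countable I" "countable J"
    and cov: "E \<subseteq> (\<Union>i\<in>I. ball (c i) (r i)) \<union> (\<Union>j\<in>J. ball (c' j) (r' j))"
    and r: "\<And>i. i \<in> I \<Longrightarrow> r i \<ge> 0" "\<And>j. j \<in> J \<Longrightarrow> r' j \<ge> 0"
  shows "hausdorff_content \<beta> E \<le> (\<integral>\<^sup>+ i. ennreal (r i powr \<beta>) \<partial>count_space I) + (\<integral>\<^sup>+ j. ennreal (r' j powr \<beta>) \<partial>count_space J)"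
proof -
  let ?r = "case_sum r r'"
  have disj: "Inl ` I \<inter> Inr ` J = {}" by auto
  have "hausdorff_content \<beta> E \<le> (\<integral>\<^sup>+ k. ennreal (?r k powr \<beta>) \<partial>count_space (Inl ` I \<union> Inr ` J))"
    using assms by (intro hausdorff_content_le_nn_integral_count_space[where c = "case_sum c c'"]) (auto simp: UN_Un)
  also have "\<dots> = (\<integral>\<^sup>+ k. ennreal (?r k powr \<beta>) \<partial>count_space (Inl ` I)) + (\<integral>\<^sup>+ k. ennreal (?r k powr \<beta>) \<partial>count_space (Inr ` J))"
    using nn_integral_disjoint_pair_countspace[of "Inl ` I" "Inr ` J" "\<lambda>k. ennreal (?r k powr \<beta>)", OF disj]
    by (simp add: nn_integral_count_space_indicator)
  also have "\<dots> = (\<integral>\<^sup>+ i. ennreal (?r (Inl i) powr \<beta>) \<partial>count_space I) + (\<integral>\<^sup>+ j. ennreal (?r (Inr j) powr \<beta>) \<partial>count_space J)"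
    by (intro arg_cong2[where f="(+)"] nn_integral_bij_count_space[symmetric] inj_on_imp_bij_betw) auto
  finally show ?thesis by simp
qed

text \<open>Subadditivity of the concave power \<open>q\<close> for sums over any index set. If some
  term is at least \<open>r\<close>, it suffices alone; otherwise every term is below
  \<open>r\<close>, and since \<open>q - 1 \<le> 0\<close>,
  \<open>r powr (q - 1) * a i \<le> a i powr q\<close> can be summed.\<close>

lemma powr_le_nn_integral_count_space_powr:
  assumes q: "0 \<le> q" "q \<le> 1" and r: "r > 0" and a: "\<And>i. i \<in> I \<Longrightarrow> a i \<ge> 0"
    and le: "ennreal r \<le> (\<integral>\<^sup>+ i. ennreal (a i) \<partial>count_space I)"
  shows "ennreal (r powr q) \<le> (\<integral>\<^sup>+ i. ennreal (a i powr q) \<partial>count_space I)"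
proof (cases "\<exists>i\<in>I. a i \<ge> r")
  case True
  then obtain i where i: "i \<in> I" "a i \<ge> r" by auto
  have "ennreal (r powr q) \<le> ennreal (a i powr q)"
    using i r q by (intro ennreal_leI powr_mono2) auto
  also have "\<dots> \<le> (\<integral>\<^sup>+ i. ennreal (a i powr q) \<partial>count_space I)"
    by (rule nn_integral_ge_point) fact
  finally show ?thesis .
next
  case False
  have "ennreal (r powr (q - 1)) * ennreal r \<le> ennreal (r powr (q - 1)) * (\<integral>\<^sup>+ i. ennreal (a i) \<partial>count_space I)"
    using le by (rule mult_left_mono) simp
  also have "\<dots> = (\<integral>\<^sup>+ i. ennreal (r powr (q - 1)) * ennreal (a i) \<partial>count_space I)"
    by (rule nn_integral_cmult[symmetric]) simp
  also have "\<dots> \<le> (\<integral>\<^sup>+ i. ennreal (a i powr q) \<partial>count_space I)"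
  proof (rule nn_integral_mono, goal_cases)
    case (1 i)
    then have i: "0 \<le> a i" "a i < r" using a False by auto
    have "r powr (q - 1) * a i \<le> a i powr q"
    proof (cases "a i = 0")
      case False
      then have "r powr (q - 1) * a i \<le> a i powr (q - 1) * a i"
        using i q by (intro mult_right_mono powr_mono2') auto
      also have "\<dots> = a i powr q" using i False by (simp add: powr_diff)
      finally show ?thesis .
    qed simp
    then show ?case using i by (simp add: ennreal_mult''[symmetric] ennreal_leI)
  qed
  also have "ennreal (r powr (q - 1)) * ennreal r = ennreal (r powr q)"
    using r by (simp add: ennreal_mult''[symmetric] powr_diff)
  finally show ?thesis .
qed

lemma borel_measurable_nn_integral_count_space:
  fixes f :: "'i \<Rightarrow> 'a \<Rightarrow> ennreal"
  assumes "countable I" and "\<And>i. i \<in> I \<Longrightarrow> f i \<in> borel_measurable M"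
  shows "(\<lambda>x. \<integral>\<^sup>+ i. f i x \<partial>count_space I) \<in> borel_measurable M"
proof -
  interpret sigma_finite_measure "count_space I"
    using assms(1) by (rule sigma_finite_measure_count_space_countable)
  have "(\<lambda>(i, x). f i x) \<in> borel_measurable (count_space I \<Otimes>\<^sub>M M)"
    by (rule measurable_pair_measure_countable1) (use assms in auto)
  from measurable_pair_swap[OF this] show ?thesis
    by (intro borel_measurable_nn_integral) simp
qed

text \<open>The weak-type bound for the maximal function. Points near one of the balls \<open>ball (x i) (l i)\<close> are
  covered by dilated balls; a ball \<open>ball y r\<close> around any other point \<open>y\<close> meets only much smaller
  balls of the family, so after a Vitali selection every \<open>i\<close> is charged at most once.\<close>

lemma hausdorff_content_maximal_le:
  fixes x :: "'i \<Rightarrow> 'a::euclidean_space" and f :: "'a \<Rightarrow> ennreal"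
  assumes I: "countable I"
    and f: "\<And>y. f y \<le> ennreal \<tau> + (\<integral>\<^sup>+ i. ennreal (a i) * indicator (ball (x i) (l i)) y \<partial>count_space I)"
    and l: "\<And>i. i \<in> I \<Longrightarrow> l i \<ge> 0" and a: "\<And>i. i \<in> I \<Longrightarrow> a i \<ge> \<kappa> * t"
    and \<kappa>: "\<kappa> > 0" and t: "t > 0" and \<tau>: "0 \<le> \<tau>" "\<tau> * unit_ball_vol (DIM('a)) \<le> t / 2"
    and \<delta>: "0 < \<delta>" "\<delta> \<le> real DIM('a)"
    and E: "\<And>y. y \<in> E \<Longrightarrow> \<exists>r\<in>{0<..\<rho>}. ennreal (t * r ^ DIM('a)) < (\<integral>\<^sup>+ z \<in> ball y r. f z \<partial>lborel)"
  shows "hausdorff_content \<delta> E \<le>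
     ennreal ((4 / \<kappa> powr (1 / DIM('a))) powr \<delta> + 10 powr \<delta> * (2 * unit_ball_vol (DIM('a))) powr (\<delta> / DIM('a))) *
     (\<integral>\<^sup>+ i. ennreal ((a i / t) powr (\<delta> / DIM('a)) * l i powr \<delta>) \<partial>count_space I)"
proof -
  define n where "n = real DIM('a)"
  define \<omega> where "\<omega> = unit_ball_vol (DIM('a))"
  have n: "n > 0" by (simp add: n_def)
  have \<omega>: "\<omega> > 0" unfolding \<omega>_def by (rule unit_ball_vol_pos) simp
  have pw: "(r ^ DIM('a)) powr (\<delta> / n) = r powr \<delta>" if "r \<ge> 0" for r :: real
    using that n by (cases "r = 0") (auto simp: n_def powr_realpow[symmetric] powr_powr)
  define w where "w = (\<lambda>i. (a i / t) powr (\<delta> / n) * l i powr \<delta>)"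
  have a0: "a i > 0" if "i \<in> I" for i using a[OF that] \<kappa> t by (meson less_le_trans mult_pos_pos)
  define k where "k = 4 / \<kappa> powr (1 / n)"
  have k: "k > 0" using \<kappa> by (simp add: k_def)
  \<comment> \<open>The dilation is chosen so that \<open>b i powr \<delta>\<close> is a constant
    multiple of the term \<open>w i\<close> of the right-hand side. The lower bound
    \<open>a i / t \<ge> \<kappa>\<close> and the choice of \<open>k\<close> ensure that it enlarges
    the radius at least fourfold.\<close>
  define b where "b = (\<lambda>i. k * (a i / t) powr (1 / n) * l i)"
  have b: "b i \<ge> 4 * l i" "b i powr \<delta> = k powr \<delta> * w i" if i: "i \<in> I" for i
  proof -
    have "\<kappa> \<le> a i / t" using a[OF i] t by (simp add: field_simps)
    then have "\<kappa> powr (1 / n) \<le> (a i / t) powr (1 / n)"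
      using \<kappa> n by (intro powr_mono2) auto
    then have "4 \<le> k * (a i / t) powr (1 / n)"
      using \<kappa> by (simp add: k_def field_simps)
    then show "b i \<ge> 4 * l i" unfolding b_def using l[OF i] by (intro mult_right_mono)
    show "b i powr \<delta> = k powr \<delta> * w i"
      using k a0[OF i] t l[OF i] by (simp add: b_def w_def powr_mult powr_powr)
  qed
  define S where "S = E - (\<Union>i\<in>I. ball (x i) (b i))"
  have "\<forall>y\<in>S. \<exists>r. 0 < r \<and> r \<le> \<rho> \<and> ennreal (t * r ^ DIM('a)) < (\<integral>\<^sup>+ z \<in> ball y r. f z \<partial>lborel)"
    using E by (fastforce simp: S_def)
  then obtain r where r: "0 < r y" "r y \<le> \<rho>" "ennreal (t * r y ^ DIM('a)) < (\<integral>\<^sup>+ z \<in> ball y (r y). f z \<partial>lborel)"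
    if "y \<in> S" for y
    by metis
  \<comment> \<open>Vitali is applied to the doubled balls, because the centres of all family
    members that meet \<open>ball y (r y)\<close> will be located in
    \<open>ball y (2 * r y)\<close>.\<close>
  obtain Y where Y: "countable Y" "Y \<subseteq> S"
    and dis: "pairwise (\<lambda>i j. disjnt (ball i (2 * r i)) (ball j (2 * r j))) Y"
    and covY: "S \<subseteq> (\<Union>y\<in>Y. ball y (5 * (2 * r y)))"
  proof (rule Vitali_covering_lemma_balls[where S = S and K = S and a = "\<lambda>y. y" and r = "\<lambda>y. 2 * r y" and B = "2 * \<rho>"])
    show "S \<subseteq> (\<Union>i\<in>S. ball i (2 * r i))" using r by force
    show "0 < 2 * r i \<and> 2 * r i \<le> 2 * \<rho>" if "i \<in> S" for i using r[OF that] by simp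
  qed
  define J where "J = (\<lambda>y. {i\<in>I. ball (x i) (l i) \<inter> ball y (r y) \<noteq> {}})"
  \<comment> \<open>As \<open>y\<close> avoids the dilated balls,
    \<open>4 * l i \<le> dist (x i) y \<le> l i + r y\<close>. Hence \<open>l i\<close> is at most a
    third of \<open>r y\<close>, and the centre is within \<open>2 * r y\<close> of
    \<open>y\<close>.\<close>
  have J: "x i \<in> ball y (2 * r y)" if "y \<in> S" "i \<in> J y" for i y
  proof -
    have "i \<in> I" and "ball (x i) (l i) \<inter> ball y (r y) \<noteq> {}" using that unfolding J_def by blast+
    then obtain z where z: "i \<in> I" "dist (x i) z < l i" "dist y z < r y" unfolding mem_ball[symmetric] by blast
    have "y \<notin> ball (x i) (b i)" using that z by (auto simp: S_def)
    then have "4 * l i \<le> dist (x i) y" using b(1)[OF z(1)] by simp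
    also have "\<dots> \<le> l i + r y" using z dist_triangle2[of "x i" y z] by simp
    finally show ?thesis
      using z dist_triangle2[of y "x i" z] zero_le_dist[of "x i" z] by (simp del: zero_le_dist)
  qed
  have meas[measurable]: "ball y r \<in> sets borel" for y :: 'a and r by simp
  \<comment> \<open>The part of \<open>f\<close> below \<tau> accounts for at most half of
    \<open>t * r y ^ DIM('a)\<close>, so the balls in \<open>J y\<close> supply the other
    half.\<close>
  have charge: "ennreal (r y powr \<delta>) \<le> ennreal ((2 * \<omega>) powr (\<delta> / n)) * (\<integral>\<^sup>+ i. ennreal (w i) * indicator (J y) i \<partial>count_space I)"
    if y: "y \<in> S" for y
  proof -
    note ry = r[OF y]
    let ?h = "ennreal (t / 2 * r y ^ DIM('a))"
    have "(\<integral>\<^sup>+ z \<in> ball y (r y). f z \<partial>lborel) \<le>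
      (\<integral>\<^sup>+ z. ennreal \<tau> * indicator (ball y (r y)) z + (\<integral>\<^sup>+ i. ennreal (a i) * indicator (ball (x i) (l i) \<inter> ball y (r y)) z \<partial>count_space I) \<partial>lborel)"
    proof (rule nn_integral_mono, goal_cases)
      case (1 z)
      show ?case using f[of z] by (auto simp: indicator_def)
    qed
    also have "\<dots> = (\<integral>\<^sup>+ z. ennreal \<tau> * indicator (ball y (r y)) z \<partial>lborel)
       + (\<integral>\<^sup>+ z. (\<integral>\<^sup>+ i. ennreal (a i) * indicator (ball (x i) (l i) \<inter> ball y (r y)) z \<partial>count_space I) \<partial>lborel)"
    proof (rule nn_integral_add)
      show "(\<lambda>z. \<integral>\<^sup>+ i. ennreal (a i) * indicator (ball (x i) (l i) \<inter> ball y (r y)) z \<partial>count_space I) \<in> borel_measurable lborel"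
        using I by (intro borel_measurable_nn_integral_count_space) simp_all
    qed measurable
    also have "(\<integral>\<^sup>+ z. (\<integral>\<^sup>+ i. ennreal (a i) * indicator (ball (x i) (l i) \<inter> ball y (r y)) z \<partial>count_space I) \<partial>lborel)
      = (\<integral>\<^sup>+ i. (\<integral>\<^sup>+ z. ennreal (a i) * indicator (ball (x i) (l i) \<inter> ball y (r y)) z \<partial>lborel) \<partial>count_space I)"
      by (rule nn_integral_count_space_nn_integral[OF I]) simp
    also have "\<dots> \<le> (\<integral>\<^sup>+ i. ennreal (\<omega> * a i * l i ^ DIM('a)) * indicator (J y) i \<partial>count_space I)"
    proof (rule nn_integral_mono, goal_cases)
      case (1 i)
      then have i: "i \<in> I" by simp
      show ?case
      proof (cases "i \<in> J y")
        case True
        have "(\<integral>\<^sup>+ z. ennreal (a i) * indicator (ball (x i) (l i) \<inter> ball y (r y)) z \<partial>lborel) = ennreal (a i) * emeasure lborel (ball (x i) (l i) \<inter> ball y (r y))"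
          by (rule nn_integral_cmult_indicator) simp
        also have "\<dots> \<le> ennreal (a i) * emeasure lborel (ball (x i) (l i))"
          by (intro mult_left_mono emeasure_mono) auto
        also have "\<dots> = ennreal (\<omega> * a i * l i ^ DIM('a))"
          using a0[OF i] l[OF i] \<omega> by (simp add: emeasure_ball \<omega>_def[symmetric] ennreal_mult'[symmetric] mult_ac)
        finally show ?thesis using True by simp
      next
        case False
        then have "ball (x i) (l i) \<inter> ball y (r y) = {}" using i by (simp add: J_def)
        then show ?thesis by simp
      qed
    qed
    also have "(\<integral>\<^sup>+ z. ennreal \<tau> * indicator (ball y (r y)) z \<partial>lborel) = ennreal (\<tau> * \<omega> * r y ^ DIM('a))"
      using ry \<tau> \<omega> by (simp add: nn_integral_cmult_indicator emeasure_ball \<omega>_def[symmetric] ennreal_mult'[symmetric] mult_ac)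
    also have "ennreal (\<tau> * \<omega> * r y ^ DIM('a)) \<le> ?h"
      using \<tau> ry by (intro ennreal_leI mult_right_mono) (auto simp: \<omega>_def)
    finally have "ennreal (t * r y ^ DIM('a)) \<le> ?h + (\<integral>\<^sup>+ i. ennreal (\<omega> * a i * l i ^ DIM('a)) * indicator (J y) i \<partial>count_space I)"
      using ry(3) by (simp add: add_mono order_trans[OF less_imp_le])
    moreover have "ennreal (t * r y ^ DIM('a)) = ?h + ?h"
      using t ry by (subst ennreal_plus[symmetric]) auto
    ultimately have "?h \<le> (\<integral>\<^sup>+ i. ennreal (\<omega> * a i * l i ^ DIM('a)) * indicator (J y) i \<partial>count_space I)"
      by (simp add: ennreal_add_left_cancel_le)
    then have "ennreal (2 / t) * ?h \<le> ennreal (2 / t) * (\<integral>\<^sup>+ i. ennreal (\<omega> * a i * l i ^ DIM('a)) * indicator (J y) i \<partial>count_space I)"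
      by (rule mult_left_mono) simp
    also have "\<dots> = (\<integral>\<^sup>+ i. ennreal (2 / t) * (ennreal (\<omega> * a i * l i ^ DIM('a)) * indicator (J y) i) \<partial>count_space I)"
      by (rule nn_integral_cmult[symmetric]) simp
    also have "\<dots> = (\<integral>\<^sup>+ i. ennreal (2 * \<omega> * (a i / t) * l i ^ DIM('a) * indicator (J y) i) \<partial>count_space I)"
      using t \<omega> a0 l by (intro nn_integral_cong) (auto simp: indicator_def ennreal_mult'[symmetric] mult.assoc)
    also have "ennreal (2 / t) * ?h = ennreal (r y ^ DIM('a))"
      using t by (simp add: ennreal_mult'[symmetric])
    \<comment> \<open>Here \<open>\<delta> \<le> DIM('a)\<close> is used: the power
      \<open>\<delta> / n \<le> 1\<close> may be taken term by term, turning volumes into the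
      quantities \<open>w i\<close>.\<close>
    finally have "ennreal ((r y ^ DIM('a)) powr (\<delta> / n)) \<le>
        (\<integral>\<^sup>+ i. ennreal ((2 * \<omega> * (a i / t) * l i ^ DIM('a) * indicator (J y) i) powr (\<delta> / n)) \<partial>count_space I)"
      using \<delta> n ry t \<omega> l less_imp_le[OF a0]
      by (intro powr_le_nn_integral_count_space_powr) (auto simp: n_def intro!: mult_nonneg_nonneg divide_nonneg_pos)
    also have "\<dots> = (\<integral>\<^sup>+ i. ennreal ((2 * \<omega>) powr (\<delta> / n)) * (ennreal (w i) * indicator (J y) i) \<partial>count_space I)"
    proof (rule nn_integral_cong, goal_cases)
      case (1 i)
      then have i: "0 < a i" "0 \<le> l i" using a0 l by auto
      then have "(2 * \<omega> * (a i / t) * l i ^ DIM('a)) powr (\<delta> / n) = (2 * \<omega>) powr (\<delta> / n) * w i"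
        by (simp only: powr_mult w_def pw[OF i(2)] mult.assoc)
      then show ?case using i by (auto simp: indicator_def ennreal_mult' w_def)
    qed
    also have "\<dots> = ennreal ((2 * \<omega>) powr (\<delta> / n)) * (\<integral>\<^sup>+ i. ennreal (w i) * indicator (J y) i \<partial>count_space I)"
      by (rule nn_integral_cmult) simp
    finally show ?thesis using ry pw by simp
  qed
  have "hausdorff_content \<delta> E \<le> (\<integral>\<^sup>+ i. ennreal (b i powr \<delta>) \<partial>count_space I) + (\<integral>\<^sup>+ y. ennreal ((10 * r y) powr \<delta>) \<partial>count_space Y)"
  proof (rule hausdorff_content_le_two_covers[where c = x and c' = "\<lambda>y. y"])
    show "E \<subseteq> (\<Union>i\<in>I. ball (x i) (b i)) \<union> (\<Union>y\<in>Y. ball y (10 * r y))"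
      using covY by (auto simp: S_def)
    show "b i \<ge> 0" if "i \<in> I" for i using b(1)[OF that] l[OF that] by linarith
    show "10 * r y \<ge> 0" if "y \<in> Y" for y using r(1)[of y] that Y by auto
  qed (use I Y in auto)
  also have "(\<integral>\<^sup>+ i. ennreal (b i powr \<delta>) \<partial>count_space I) = ennreal (k powr \<delta>) * (\<integral>\<^sup>+ i. ennreal (w i) \<partial>count_space I)"
    by (subst nn_integral_cmult[symmetric]) (auto intro!: nn_integral_cong simp: b ennreal_mult' w_def)
  also have "(\<integral>\<^sup>+ y. ennreal ((10 * r y) powr \<delta>) \<partial>count_space Y)
     \<le> (\<integral>\<^sup>+ y. ennreal (10 powr \<delta> * (2 * \<omega>) powr (\<delta> / n)) * (\<integral>\<^sup>+ i. ennreal (w i) * indicator (J y) i \<partial>count_space I) \<partial>count_space Y)"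
  proof (rule nn_integral_mono, goal_cases)
    case (1 y)
    then have y: "y \<in> S" using Y by auto
    have "ennreal ((10 * r y) powr \<delta>) = ennreal (10 powr \<delta>) * ennreal (r y powr \<delta>)"
      using r(1)[OF y] by (simp add: powr_mult ennreal_mult')
    also have "\<dots> \<le> ennreal (10 powr \<delta>) * (ennreal ((2 * \<omega>) powr (\<delta> / n)) * (\<integral>\<^sup>+ i. ennreal (w i) * indicator (J y) i \<partial>count_space I))"
      by (intro mult_left_mono charge[OF y]) simp
    finally show ?case by (simp add: ennreal_mult' mult.assoc)
  qed
  also have "\<dots> = ennreal (10 powr \<delta> * (2 * \<omega>) powr (\<delta> / n)) * (\<integral>\<^sup>+ y. (\<integral>\<^sup>+ i. ennreal (w i) * indicator (J y) i \<partial>count_space I) \<partial>count_space Y)"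
    by (rule nn_integral_cmult) simp
  also have "(\<integral>\<^sup>+ y. (\<integral>\<^sup>+ i. ennreal (w i) * indicator (J y) i \<partial>count_space I) \<partial>count_space Y)
    = (\<integral>\<^sup>+ i. (\<integral>\<^sup>+ y. ennreal (w i) * indicator (J y) i \<partial>count_space Y) \<partial>count_space I)"
    by (rule nn_integral_count_space_nn_integral[OF I]) simp
  also have "\<dots> \<le> (\<integral>\<^sup>+ i. ennreal (w i) \<partial>count_space I)"
  proof (rule nn_integral_mono, goal_cases)
    case (1 i)
    \<comment> \<open>The centre \<open>x i\<close> would lie in two of the disjoint doubled
      balls.\<close>
    have one: "y = y'" if "y \<in> Y" "y' \<in> Y" "i \<in> J y" "i \<in> J y'" for y y'
    proof (rule ccontr)
      assume "y \<noteq> y'"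
      then have "disjnt (ball y (2 * r y)) (ball y' (2 * r y'))" using dis that by (auto simp: pairwise_def)
      then show False using J[of y i] J[of y' i] that Y(2) unfolding disjnt_def by blast
    qed
    show ?case
    proof (cases "\<exists>y\<in>Y. i \<in> J y")
      case True
      then obtain y0 where y0: "y0 \<in> Y" "i \<in> J y0" by auto
      have "(\<integral>\<^sup>+ y. ennreal (w i) * indicator (J y) i \<partial>count_space Y) = (\<integral>\<^sup>+ y. ennreal (w i) * indicator {y0} y \<partial>count_space Y)"
        using one y0 by (intro nn_integral_cong) (auto simp: indicator_def)
      also have "\<dots> = ennreal (w i)" using y0 by (simp add: nn_integral_cmult_indicator)
      finally show ?thesis by simp
    next
      case False
      then have "(\<integral>\<^sup>+ y. ennreal (w i) * indicator (J y) i \<partial>count_space Y) = (\<integral>\<^sup>+ y. 0 \<partial>count_space Y)"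
        by (intro nn_integral_cong) (auto simp: indicator_def)
      then show ?thesis by simp
    qed
  qed
  finally have "hausdorff_content \<delta> E \<le> ennreal (k powr \<delta>) * (\<integral>\<^sup>+ i. ennreal (w i) \<partial>count_space I)
     + ennreal (10 powr \<delta> * (2 * \<omega>) powr (\<delta> / n)) * (\<integral>\<^sup>+ i. ennreal (w i) \<partial>count_space I)"
    by (simp add: add_left_mono mult_left_mono)
  then show ?thesis
    unfolding distrib_right[symmetric] k_def w_def \<omega>_def n_def
    by (subst ennreal_plus) auto
qed

lemma hausdorff_content_mono:
  assumes "E \<subseteq> F"
  shows "hausdorff_content \<beta> E \<le> hausdorff_content \<beta> F"
  unfolding hausdorff_content_def using assms by (intro INF_superset_mono) auto

text \<open>Sets of infinite content are included: there the bound is \<open>top\<close>, and the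
  balls of radius \<open>i\<close> around the origin cover the whole space.\<close>

lemma hausdorff_content_cover:
  fixes E :: "'a::euclidean_space set"
  assumes "e > 0"
  obtains c r where "\<And>i::nat. r i \<ge> 0" "E \<subseteq> (\<Union>i. ball (c i) (r i))"
    "(\<Sum>i. ennreal (r i powr \<beta>)) \<le> hausdorff_content \<beta> E + ennreal e"
proof (cases "hausdorff_content \<beta> E < top")
  case True
  then have "hausdorff_content \<beta> E < hausdorff_content \<beta> E + ennreal e"
    using assms by (simp add: less_top)
  then obtain c r where "(\<forall>i. r i \<ge> 0) \<and> E \<subseteq> (\<Union>i::nat. ball (c i) (r i))"
    "(\<Sum>i. ennreal (r i powr \<beta>)) < hausdorff_content \<beta> E + ennreal e"
    unfolding hausdorff_content_def[of \<beta> E] by (auto simp: INF_less_iff)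
  then show thesis by (intro that[of r c]) auto
next
  case False
  have "E \<subseteq> (\<Union>i. ball 0 (real i))"
  proof
    fix y
    obtain i :: nat where "norm y < real i" using reals_Archimedean2 by blast
    then show "y \<in> (\<Union>i. ball 0 (real i))" by auto
  qed
  moreover have "hausdorff_content \<beta> E + ennreal e = top"
    using False by (simp add: less_top[symmetric])
  ultimately show thesis by (intro that[of real "\<lambda>_. 0"]) simp_all
qed

section \<open>Dyadic discretisation of the Choquet integral\<close>

text \<open>For positive \<open>p\<close> and \<Lambda> these are the images of the intervals from
  \<open>\<Lambda> * 2 powr k\<close> to \<open>2 * \<Lambda> * 2 powr k\<close> under the power
  \<open>p\<close>. They tile the positive half-line, so a level of \<open>w powr p\<close> in the
  k-th one corresponds to a level of \<open>w\<close> between two consecutive dyadic multiples of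
  \<Lambda>.\<close>

definition dyadic_interval :: "real \<Rightarrow> real \<Rightarrow> int \<Rightarrow> real set" where
  "dyadic_interval p \<Lambda> k = {(\<Lambda> * 2 powr k) powr p ..< (2 * \<Lambda> * 2 powr k) powr p}"

lemma sets_dyadic_interval [measurable]: "dyadic_interval p \<Lambda> k \<in> sets borel"
  by (simp add: dyadic_interval_def)

lemma emeasure_dyadic_interval:
  assumes "p > 0" "\<Lambda> > 0"
  shows "emeasure lborel (dyadic_interval p \<Lambda> k) = ennreal (\<Lambda> powr p * (2 powr p - 1) * 2 powr (p * k))"
proof -
  have "(\<Lambda> * 2 powr k) powr p \<le> (2 * \<Lambda> * 2 powr k) powr p"
    using assms by (intro powr_mono2) auto
  moreover have "(2 * \<Lambda> * 2 powr k) powr p - (\<Lambda> * 2 powr k) powr p = \<Lambda> powr p * (2 powr p - 1) * 2 powr (p * k)"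
    by (simp add: powr_mult powr_powr algebra_simps)
  ultimately show ?thesis by (simp add: dyadic_interval_def)
qed

lemma powr_le_powr_iff:
  fixes x y p :: real
  assumes "p > 0" "x \<ge> 0" "y \<ge> 0"
  shows "x powr p \<le> y powr p \<longleftrightarrow> x \<le> y"
  using powr_mono2[of p x y] powr_less_mono2[of p y x] assms by linarith

lemma in_dyadic_interval_iff:
  assumes p: "p > 0" and \<Lambda>: "\<Lambda> > 0" and \<tau>: "\<tau> > 0"
  shows "\<tau> \<in> dyadic_interval p \<Lambda> k \<longleftrightarrow> \<lfloor>log 2 (\<tau> powr (1 / p) / \<Lambda>)\<rfloor> = k"
proof -
  define x where "x = \<tau> powr (1 / p)"
  have x: "x > 0" "\<tau> = x powr p" using p \<tau> by (auto simp: powr_powr x_def)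
  have "(\<Lambda> * 2 powr k) powr p \<le> \<tau> \<longleftrightarrow> \<Lambda> * 2 powr k \<le> x"
    using p \<Lambda> x(1) unfolding x(2) by (intro powr_le_powr_iff) auto
  moreover have "(2 * \<Lambda> * 2 powr k) powr p \<le> \<tau> \<longleftrightarrow> 2 * \<Lambda> * 2 powr k \<le> x"
    using p \<Lambda> x(1) unfolding x(2) by (intro powr_le_powr_iff) auto
  ultimately have "\<tau> \<in> dyadic_interval p \<Lambda> k \<longleftrightarrow> \<Lambda> * 2 powr k \<le> x \<and> x < 2 * \<Lambda> * 2 powr k"
    by (auto simp: dyadic_interval_def)
  also have "\<dots> \<longleftrightarrow> 2 powr k \<le> x / \<Lambda> \<and> x / \<Lambda> < 2 powr (real_of_int k + 1)"
    using \<Lambda> by (auto simp: field_simps powr_add)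
  also have "\<dots> \<longleftrightarrow> \<lfloor>log 2 (x / \<Lambda>)\<rfloor> = k"
    using x \<Lambda> by (subst floor_log_eq_powr_iff) auto
  finally show ?thesis by (simp add: x_def)
qed

text \<open>For levels in the k-th interval, the superlevel set of \<open>w powr p\<close> is
  contained in that of \<open>w\<close> at the lower endpoint; the coefficient is the length of the
  interval.\<close>

lemma choquet_integral_powr_le_dyadic:
  fixes w :: "'a::euclidean_space \<Rightarrow> real"
  assumes p: "p > 0" and \<Lambda>: "\<Lambda> > 0" and w: "\<And>x. w x \<ge> 0"
  shows "choquet_integral \<beta> \<Omega> (\<lambda>x. w x powr p) \<le>
    (\<integral>\<^sup>+ k. ennreal (\<Lambda> powr p * (2 powr p - 1) * 2 powr (p * real_of_int k)) *
        hausdorff_content \<beta> {x\<in>\<Omega>. w x > \<Lambda> * 2 powr k} \<partial>count_space UNIV)"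
proof -
  let ?H = "\<lambda>k::int. hausdorff_content \<beta> {x\<in>\<Omega>. w x > \<Lambda> * 2 powr k}"
  have "choquet_integral \<beta> \<Omega> (\<lambda>x. w x powr p) \<le>
     (\<integral>\<^sup>+ \<tau>. (\<integral>\<^sup>+ k. ?H k * indicator (dyadic_interval p \<Lambda> k) \<tau> \<partial>count_space UNIV) \<partial>lborel)"
    unfolding choquet_integral_def
  proof (rule nn_integral_mono_AE)
    \<comment> \<open>The level 0 lies in none of the intervals, but a single point is
      negligible.\<close>
    have "AE \<tau> in lborel. \<tau> \<noteq> (0::real)" by (rule AE_lborel_singleton)
    then show "AE \<tau> in lborel. indicator {0..} \<tau> * hausdorff_content \<beta> {x\<in>\<Omega>. w x powr p > \<tau>} \<le>
       (\<integral>\<^sup>+ k. ?H k * indicator (dyadic_interval p \<Lambda> k) \<tau> \<partial>count_space UNIV)"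
    proof eventually_elim
      case (elim \<tau>)
      show ?case
      proof (cases "\<tau> > 0")
        case True
        define k where "k = \<lfloor>log 2 (\<tau> powr (1 / p) / \<Lambda>)\<rfloor>"
        have k: "\<tau> \<in> dyadic_interval p \<Lambda> k" using in_dyadic_interval_iff[OF p \<Lambda> True] by (simp add: k_def)
        have "w x > \<Lambda> * 2 powr k" if "w x powr p > \<tau>" for x
        proof (rule ccontr)
          assume "\<not> ?thesis"
          then have "w x powr p \<le> (\<Lambda> * 2 powr k) powr p" using p w by (intro powr_mono2) auto
          then show False using that k by (auto simp: dyadic_interval_def)
        qed
        then have "hausdorff_content \<beta> {x\<in>\<Omega>. w x powr p > \<tau>} \<le> ?H k"
          by (intro hausdorff_content_mono) auto
        also have "\<dots> = ?H k * indicator (dyadic_interval p \<Lambda> k) \<tau>" using k by simp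
        also have "\<dots> \<le> (\<integral>\<^sup>+ k. ?H k * indicator (dyadic_interval p \<Lambda> k) \<tau> \<partial>count_space UNIV)"
          by (rule nn_integral_ge_point) simp
        finally show ?thesis using True by simp
      qed (use elim in simp)
    qed
  qed
  also have "\<dots> = (\<integral>\<^sup>+ k. (\<integral>\<^sup>+ \<tau>. ?H k * indicator (dyadic_interval p \<Lambda> k) \<tau> \<partial>lborel) \<partial>count_space UNIV)"
    by (rule nn_integral_count_space_nn_integral) (auto intro: measurable)
  also have "\<dots> = (\<integral>\<^sup>+ k. ennreal (\<Lambda> powr p * (2 powr p - 1) * 2 powr (p * real_of_int k)) * ?H k \<partial>count_space UNIV)"
    by (intro nn_integral_cong, subst nn_integral_cmult_indicator)
      (simp_all add: emeasure_dyadic_interval[OF p \<Lambda>] mult.commute)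
  finally show ?thesis .
qed

text \<open>The reverse comparison takes the upper endpoint: if \<open>w\<close> exceeds it, then
  \<open>w powr p\<close> exceeds every level in the interval.\<close>

lemma dyadic_le_choquet_integral_powr:
  fixes w :: "'a::euclidean_space \<Rightarrow> real"
  assumes p: "p > 0" and \<Lambda>: "\<Lambda> > 0"
  shows "(\<integral>\<^sup>+ k. ennreal (\<Lambda> powr p * (2 powr p - 1) * 2 powr (p * real_of_int k)) *
        hausdorff_content \<beta> {x\<in>\<Omega>. w x > 2 * \<Lambda> * 2 powr k} \<partial>count_space UNIV)
    \<le> choquet_integral \<beta> \<Omega> (\<lambda>x. w x powr p)"
proof -
  let ?H = "\<lambda>k::int. hausdorff_content \<beta> {x\<in>\<Omega>. w x > 2 * \<Lambda> * 2 powr k}"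
  have "(\<integral>\<^sup>+ k. ennreal (\<Lambda> powr p * (2 powr p - 1) * 2 powr (p * real_of_int k)) * ?H k \<partial>count_space UNIV)
     = (\<integral>\<^sup>+ k. (\<integral>\<^sup>+ \<tau>. ?H k * indicator (dyadic_interval p \<Lambda> k) \<tau> \<partial>lborel) \<partial>count_space UNIV)"
    by (intro nn_integral_cong, subst nn_integral_cmult_indicator)
      (simp_all add: emeasure_dyadic_interval[OF p \<Lambda>] mult.commute)
  also have "\<dots> = (\<integral>\<^sup>+ \<tau>. (\<integral>\<^sup>+ k. ?H k * indicator (dyadic_interval p \<Lambda> k) \<tau> \<partial>count_space UNIV) \<partial>lborel)"
    by (rule nn_integral_count_space_nn_integral[symmetric]) (auto intro: measurable)
  also have "\<dots> \<le> choquet_integral \<beta> \<Omega> (\<lambda>x. w x powr p)"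
    unfolding choquet_integral_def
  proof (rule nn_integral_mono, goal_cases)
    case (1 \<tau>)
    show ?case
    proof (cases "\<tau> > 0")
      case True
      define k where "k = \<lfloor>log 2 (\<tau> powr (1 / p) / \<Lambda>)\<rfloor>"
      have k: "\<tau> \<in> dyadic_interval p \<Lambda> j \<longleftrightarrow> j = k" for j
        using in_dyadic_interval_iff[OF p \<Lambda> True] by (auto simp: k_def)
      have "(\<integral>\<^sup>+ j. ?H j * indicator (dyadic_interval p \<Lambda> j) \<tau> \<partial>count_space UNIV) = (\<integral>\<^sup>+ j. ?H j * indicator {k} j \<partial>count_space UNIV)"
        by (intro nn_integral_cong) (auto simp: indicator_def k)
      also have "\<dots> = ?H k" by simp
      also have "\<dots> \<le> hausdorff_content \<beta> {x\<in>\<Omega>. w x powr p > \<tau>}"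
      proof (rule hausdorff_content_mono, clarify)
        fix x assume "w x > 2 * \<Lambda> * 2 powr k"
        then have "(2 * \<Lambda> * 2 powr k) powr p \<le> w x powr p" using p \<Lambda> by (intro powr_mono2) auto
        then show "w x powr p > \<tau>" using k[of k] by (auto simp: dyadic_interval_def)
      qed
      finally show ?thesis using True by simp
    next
      case False
      have "\<tau> \<notin> dyadic_interval p \<Lambda> k" for k
      proof -
        have "0 < (\<Lambda> * 2 powr k) powr p" using \<Lambda> by simp
        then have "\<tau> < (\<Lambda> * 2 powr k) powr p" using False by linarith
        then show ?thesis by (simp add: dyadic_interval_def)
      qed
      then show ?thesis by simp
    qed
  qed
  finally show ?thesis .
qed

section \<open>From the weak-type bound to the strong maximal inequality\<close>

text \<open>The weak-type bound at height \<open>2 powr m\<close>, applied to the covering balls of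
  all levels \<open>k \<ge> m - c0\<close>, each carrying the height \<open>2 powr (k + 1)\<close>.
  Values of \<open>f\<close> up to \<open>2 powr (m - c0)\<close> go into the constant \<tau>, which
  \<open>c0\<close> makes small enough.\<close>

lemma hausdorff_content_maximal_dyadic_le:
  fixes f :: "'a::euclidean_space \<Rightarrow> real" and c :: "int \<Rightarrow> nat \<Rightarrow> 'a" and m :: int
  assumes \<delta>: "0 < \<delta>" "\<delta> \<le> real DIM('a)" and l: "\<And>k i. l k i \<ge> 0"
    and cov: "\<And>k::int. {z\<in>\<Omega>. f z > 2 powr k} \<subseteq> (\<Union>i. ball (c k i) (l k i))"
    and c0: "2 powr (- real c0) * unit_ball_vol (DIM('a)) \<le> 1 / 2"
    and E: "\<And>y. y \<in> E \<Longrightarrow> \<exists>r\<in>{0<..\<rho>}. ennreal (2 powr m * r ^ DIM('a)) < (\<integral>\<^sup>+ z \<in> ball y r \<inter> \<Omega>. ennreal (f z) \<partial>lborel)"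
  shows "hausdorff_content \<delta> E \<le>
     ennreal ((4 / (2 powr (- real c0)) powr (1 / DIM('a))) powr \<delta> + 10 powr \<delta> * (2 * unit_ball_vol (DIM('a))) powr (\<delta> / DIM('a))) *
     (\<integral>\<^sup>+ k. ennreal (2 powr (\<delta> / DIM('a) * (real_of_int k + 1 - real_of_int m))) * (\<Sum>i. ennreal (l k i powr \<delta>)) * indicator {m - int c0..} k \<partial>count_space UNIV)"
    (is "_ \<le> ennreal ?C * _")
proof -
  let ?I = "{m - int c0..} \<times> (UNIV :: nat set)"
  let ?a = "\<lambda>(k::int, i::nat). 2 powr (real_of_int k + 1)"
  let ?w = "\<lambda>ki. (?a ki / 2 powr m) powr (\<delta> / DIM('a)) * case_prod l ki powr \<delta>"
  have "hausdorff_content \<delta> E \<le> ennreal ?C * (\<integral>\<^sup>+ ki. ennreal (?w ki) \<partial>count_space ?I)"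
  proof (rule hausdorff_content_maximal_le[where f = "\<lambda>z. ennreal (f z) * indicator \<Omega> z" and x = "case_prod c"
        and \<tau> = "2 powr (real_of_int m - c0)"])
    fix z
    show "ennreal (f z) * indicator \<Omega> z \<le> ennreal (2 powr (real_of_int m - c0)) +
      (\<integral>\<^sup>+ ki. ennreal (?a ki) * indicator (ball (case_prod c ki) (case_prod l ki)) z \<partial>count_space ?I)"
    proof (cases "z \<in> \<Omega> \<and> f z > 2 powr (real_of_int m - c0)")
      case True
      then have z: "z \<in> \<Omega>" "f z > 2 powr (real_of_int m - c0)" by auto
      have fz: "f z > 0" using z(2) by (rule less_trans[rotated]) simp
      \<comment> \<open>Ceiling minus one, so that
        \<open>2 powr k < f z \<le> 2 powr (k + 1)\<close>. The left inequality must be strict,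
        since the balls cover a strict superlevel set.\<close>
      define k where "k = \<lceil>log 2 (f z)\<rceil> - 1"
      have "2 powr k < f z" "f z \<le> 2 powr (real_of_int k + 1)"
        using fz by (auto simp: k_def less_log_iff[symmetric] log_le_iff[symmetric]) linarith+
      have "real_of_int (m - int c0) < log 2 (f z)" using z(2) fz by (simp add: less_log_iff)
      then have "m - int c0 \<le> k" unfolding k_def by linarith
      from cov[of k] \<open>2 powr k < f z\<close> z(1) obtain i where i: "z \<in> ball (c k i) (l k i)" by blast
      have "ennreal (f z) \<le> ennreal (?a (k, i)) * indicator (ball (case_prod c (k, i)) (case_prod l (k, i))) z"
        using i \<open>f z \<le> 2 powr (real_of_int k + 1)\<close> by (simp add: ennreal_leI)
      also have "\<dots> \<le> (\<integral>\<^sup>+ ki. ennreal (?a ki) * indicator (ball (case_prod c ki) (case_prod l ki)) z \<partial>count_space ?I)"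
        using \<open>m - int c0 \<le> k\<close> by (intro nn_integral_ge_point) simp
      finally show ?thesis using z by (simp add: add_increasing)
    next
      case False
      then have "ennreal (f z) * indicator \<Omega> z \<le> ennreal (2 powr (real_of_int m - c0))"
        by (auto simp: indicator_def ennreal_leI)
      then show ?thesis by (simp add: add_increasing2)
    qed
  next
    fix ki assume "ki \<in> ?I"
    then show "2 powr (- real c0) * 2 powr m \<le> ?a ki"
      by (auto simp: powr_add[symmetric])
  next
    fix y assume "y \<in> E"
    then show "\<exists>r\<in>{0<..\<rho>}. ennreal (2 powr m * r ^ DIM('a)) < (\<integral>\<^sup>+ z \<in> ball y r. (ennreal (f z) * indicator \<Omega> z) \<partial>lborel)"
      using E[of y] by (simp add: indicator_inter_arith mult_ac)
  next
    show "2 powr (real_of_int m - c0) * unit_ball_vol (DIM('a)) \<le> 2 powr m / 2"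
      using mult_left_mono[OF c0, of "2 powr m"] by (simp add: powr_diff powr_minus field_simps)
  qed (use \<delta> l in \<open>auto split: prod.split\<close>)
  also have "(\<integral>\<^sup>+ ki. ennreal (?w ki) \<partial>count_space ?I) = (\<integral>\<^sup>+ ki. ennreal (?w ki) * indicator ?I ki \<partial>count_space UNIV)"
    by (rule nn_integral_count_space_indicator) simp
  also have "\<dots> = (\<integral>\<^sup>+ k. \<integral>\<^sup>+ i. ennreal (?w (k, i)) * indicator ?I (k, i) \<partial>count_space UNIV \<partial>count_space UNIV)"
    by (rule nn_integral_fst_count_space[symmetric])
  also have "\<dots> = (\<integral>\<^sup>+ k. ennreal (2 powr (\<delta> / DIM('a) * (real_of_int k + 1 - real_of_int m))) * (\<Sum>i. ennreal (l k i powr \<delta>)) * indicator {m - int c0..} k \<partial>count_space UNIV)"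
  proof (rule nn_integral_cong, goal_cases)
    case (1 k)
    have "(2 powr (real_of_int k + 1) / 2 powr m) powr (\<delta> / DIM('a)) = 2 powr (\<delta> / DIM('a) * (real_of_int k + 1 - real_of_int m))"
      by (simp add: powr_diff[symmetric] powr_powr mult.commute)
    then have "(\<integral>\<^sup>+ i. ennreal (?w (k, i)) * indicator ?I (k, i) \<partial>count_space UNIV) =
      (\<integral>\<^sup>+ i. ennreal (2 powr (\<delta> / DIM('a) * (real_of_int k + 1 - real_of_int m))) * ennreal (l k i powr \<delta>) * indicator {m - int c0..} k \<partial>count_space UNIV)"
      by (intro nn_integral_cong) (auto simp: indicator_def ennreal_mult')
    then show ?case
      by (simp add: nn_integral_multc nn_integral_cmult nn_integral_count_space_nat)
  qed
  finally show ?thesis .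
qed


text \<open>\<open>E m\<close> stands for a set where the maximal function of \<open>f\<close>
  exceeds \<open>2 powr m\<close>. The weak-type bounds are weighted with
  \<open>2 powr (p * m)\<close> and summed; after exchanging the sums, each level \<open>k\<close>
  of \<open>f\<close> meets a geometric series over \<open>m \<le> k + c0\<close>, convergent
  because \<open>p > \<delta> / DIM('a)\<close>.\<close>

lemma choquet_integral_maximal_le:
  assumes \<delta>: "0 < \<delta>" "\<delta> \<le> real DIM('a::euclidean_space)" and p: "p > \<delta> / real DIM('a)"
  obtains K where "K > 0"
    "\<And>(f :: 'a \<Rightarrow> real) \<Omega> E \<rho>.
      (\<And>m y. y \<in> E m \<Longrightarrow> \<exists>r\<in>{0<..\<rho>}. ennreal (2 powr real_of_int m * r ^ DIM('a)) < (\<integral>\<^sup>+ z \<in> ball y r \<inter> \<Omega>. ennreal (f z) \<partial>lborel)) \<Longrightarrow>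
      (\<integral>\<^sup>+ m. ennreal (2 powr (p * real_of_int m)) * hausdorff_content \<delta> (E m) \<partial>count_space UNIV)
        \<le> ennreal K * choquet_integral \<delta> \<Omega> (\<lambda>x. f x powr p)"
proof -
  define q where "q = \<delta> / real DIM('a)"
  have q: "0 < q" "q < p" using \<delta> p by (auto simp: q_def)
  have p0: "p > 0" using q by simp
  obtain c0 :: nat where "2 * unit_ball_vol (DIM('a)) < 2 ^ c0"
    using real_arch_pow[of 2] by auto
  then have c0: "2 powr (- real c0) * unit_ball_vol (DIM('a)) \<le> 1 / 2"
    by (simp add: powr_minus powr_realpow field_simps)
  define C where "C = (4 / (2 powr (- real c0)) powr (1 / DIM('a))) powr \<delta> + 10 powr \<delta> * (2 * unit_ball_vol (DIM('a))) powr (\<delta> / DIM('a))"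
  have C: "C > 0" unfolding C_def by (intro add_pos_nonneg) auto
  define B where "B = 2 powr (p * c0 + q - q * c0) * (1 / (1 - 2 powr (q - p)))"
  have qp: "2 powr (q - p) < 1" using q powr_less_mono[of "q - p" 0 2] by simp
  have B: "B > 0" using qp by (simp add: B_def)
  \<comment> \<open>The coefficient of the dyadic comparison for \<open>\<Lambda> = 1/2\<close>, the
    value that turns its levels \<open>2 * \<Lambda> * 2 powr k\<close> into
    \<open>2 powr k\<close>.\<close>
  define d where "d = (1 / 2) powr p * (2 powr p - 1)"
  have d: "d > 0" using p0 powr_less_mono[of 0 p 2] by (simp add: d_def)
  have geo: "(\<integral>\<^sup>+ m. ennreal (2 powr (p * real_of_int m)) * ennreal (2 powr (q * (real_of_int k + 1 - real_of_int m))) * indicator {m - int c0..} k \<partial>count_space UNIV)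
     = ennreal (B * 2 powr (p * real_of_int k))" for k :: int
  proof -
    let ?e = "\<lambda>m. 2 powr (p * real_of_int m) * 2 powr (q * (real_of_int k + 1 - real_of_int m))"
    have "(\<integral>\<^sup>+ m. ennreal (2 powr (p * real_of_int m)) * ennreal (2 powr (q * (real_of_int k + 1 - real_of_int m))) * indicator {m - int c0..} k \<partial>count_space UNIV)
       = (\<integral>\<^sup>+ m. ennreal (?e m) * indicator {..k + int c0} m \<partial>count_space UNIV)"
      by (intro nn_integral_cong) (auto simp: indicator_def ennreal_mult')
    also have "\<dots> = (\<integral>\<^sup>+ m. ennreal (?e m) \<partial>count_space {..k + int c0})"
      by (rule nn_integral_count_space_indicator[symmetric]) simp
    \<comment> \<open>Substituting \<open>m = k + c0 - j\<close> gives powers of the ratio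
      \<open>2 powr (q - p) < 1\<close>.\<close>
    also have "\<dots> = (\<integral>\<^sup>+ (j::nat). ennreal (?e (k + int c0 - int j)) \<partial>count_space UNIV)"
    proof (rule nn_integral_bij_count_space[symmetric])
      show "bij_betw (\<lambda>j. k + int c0 - int j) UNIV {..k + int c0}"
        by (rule bij_betwI[where g = "\<lambda>m. nat (k + int c0 - m)"]) auto
    qed
    also have "\<dots> = (\<Sum>j. ennreal (2 powr (p * c0 + q - q * c0) * 2 powr (p * k) * (2 powr (q - p)) ^ j))"
      unfolding nn_integral_count_space_nat
    proof (intro suminf_cong arg_cong[where f = ennreal])
      fix j :: nat
      have "(2 powr (q - p)) ^ j = 2 powr ((q - p) * j)" by (simp add: powr_powr flip: powr_realpow)
      then show "?e (k + int c0 - int j) = 2 powr (p * c0 + q - q * c0) * 2 powr (p * k) * (2 powr (q - p)) ^ j"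
        by (simp add: powr_add[symmetric] algebra_simps)
    qed
    also have "\<dots> = ennreal (2 powr (p * c0 + q - q * c0) * 2 powr (p * k) * (1 / (1 - 2 powr (q - p))))"
      using qp by (intro suminf_ennreal_eq sums_mult geometric_sums) auto
    finally show ?thesis by (simp add: B_def mult_ac)
  qed
  show thesis
  proof (rule that[of "C * B / d"])
    show "C * B / d > 0" using C B d by simp
    fix f :: "'a \<Rightarrow> real" and \<Omega> :: "'a set" and E :: "int \<Rightarrow> 'a set" and \<rho>
    assume E: "\<And>m y. y \<in> E m \<Longrightarrow> \<exists>r\<in>{0<..\<rho>}. ennreal (2 powr real_of_int m * r ^ DIM('a)) < (\<integral>\<^sup>+ z \<in> ball y r \<inter> \<Omega>. ennreal (f z) \<partial>lborel)"
    define H where "H = (\<lambda>k::int. hausdorff_content \<delta> {z\<in>\<Omega>. f z > 2 powr k})"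
    let ?Y = "\<integral>\<^sup>+ k. ennreal (2 powr (p * real_of_int k)) * H k \<partial>count_space UNIV"
    let ?X = "\<integral>\<^sup>+ m. ennreal (2 powr (p * real_of_int m)) * hausdorff_content \<delta> (E m) \<partial>count_space UNIV"
    have eps: "?X \<le> ennreal (C * B) * (?Y + ennreal (2 * e))" if e: "e > 0" for e
    proof -
      \<comment> \<open>The tolerance at level \<open>k\<close> cancels the weight
        \<open>2 powr (p * k)\<close> and is summable over all integers through the injection
        \<open>to_nat\<close>; the weighted tolerances add up to at most
        \<open>2 * e\<close>.\<close>
      define ek where "ek = (\<lambda>k::int. e * 2 powr (- p * k) * (1/2) ^ to_nat k)"
      have ek: "ek k > 0" for k using e by (simp add: ek_def)
      have "\<forall>k. \<exists>cr. (\<forall>i::nat. snd cr i \<ge> (0::real)) \<and> {z\<in>\<Omega>. f z > 2 powr real_of_int k} \<subseteq> (\<Union>i. ball (fst cr i) (snd cr i)) \<and>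
         (\<Sum>i. ennreal (snd cr i powr \<delta>)) \<le> H k + ennreal (ek k)"
      proof
        fix k
        show "\<exists>cr. (\<forall>i::nat. snd cr i \<ge> (0::real)) \<and> {z\<in>\<Omega>. f z > 2 powr real_of_int k} \<subseteq> (\<Union>i. ball (fst cr i) (snd cr i)) \<and>
         (\<Sum>i. ennreal (snd cr i powr \<delta>)) \<le> H k + ennreal (ek k)"
        proof (rule hausdorff_content_cover[OF ek[of k], of "{z\<in>\<Omega>. f z > 2 powr real_of_int k}" \<delta>])
          fix c :: "nat \<Rightarrow> 'a" and r :: "nat \<Rightarrow> real"
          assume "\<And>i. r i \<ge> 0" "{z\<in>\<Omega>. f z > 2 powr real_of_int k} \<subseteq> (\<Union>i. ball (c i) (r i))"
            "(\<Sum>i. ennreal (r i powr \<delta>)) \<le> hausdorff_content \<delta> {z\<in>\<Omega>. f z > 2 powr real_of_int k} + ennreal (ek k)"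
          then show ?thesis by (intro exI[of _ "(c, r)"]) (simp add: H_def)
        qed
      qed
      from choice[OF this] obtain cr where cr': "\<forall>k. (\<forall>i. snd (cr k) i \<ge> (0::real)) \<and>
        {z\<in>\<Omega>. f z > 2 powr real_of_int k} \<subseteq> (\<Union>i. ball (fst (cr k) i) (snd (cr k) i)) \<and>
        (\<Sum>i. ennreal (snd (cr k) i powr \<delta>)) \<le> H k + ennreal (ek k)" ..
      have cr: "snd (cr k) i \<ge> 0"
        "{z\<in>\<Omega>. f z > 2 powr real_of_int k} \<subseteq> (\<Union>i. ball (fst (cr k) i) (snd (cr k) i))"
        "(\<Sum>i. ennreal (snd (cr k) i powr \<delta>)) \<le> H k + ennreal (ek k)" for k i
        using spec[OF cr', of k] by blast+
      have "?X \<le> (\<integral>\<^sup>+ m. ennreal (2 powr (p * real_of_int m)) * (ennreal C *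
          (\<integral>\<^sup>+ k. ennreal (2 powr (q * (real_of_int k + 1 - real_of_int m))) * (H k + ennreal (ek k)) * indicator {m - int c0..} k \<partial>count_space UNIV)) \<partial>count_space UNIV)"
      proof (intro nn_integral_mono mult_left_mono, goal_cases)
        case (1 m)
        have "hausdorff_content \<delta> (E m) \<le> ennreal C *
          (\<integral>\<^sup>+ k. ennreal (2 powr (q * (real_of_int k + 1 - real_of_int m))) * (\<Sum>i. ennreal (snd (cr k) i powr \<delta>)) * indicator {m - int c0..} k \<partial>count_space UNIV)"
          unfolding C_def q_def by (rule hausdorff_content_maximal_dyadic_le[OF \<delta> cr(1,2) c0 E])
        also have "\<dots> \<le> ennreal C *
          (\<integral>\<^sup>+ k. ennreal (2 powr (q * (real_of_int k + 1 - real_of_int m))) * (H k + ennreal (ek k)) * indicator {m - int c0..} k \<partial>count_space UNIV)"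
          by (intro mult_left_mono nn_integral_mono mult_right_mono cr(3) zero_le)
        finally show ?case .
      qed simp
      also have "\<dots> = (\<integral>\<^sup>+ m. \<integral>\<^sup>+ k. ennreal C * ((H k + ennreal (ek k)) * (ennreal (2 powr (p * real_of_int m)) *
           ennreal (2 powr (q * (real_of_int k + 1 - real_of_int m))) * indicator {m - int c0..} k)) \<partial>count_space UNIV \<partial>count_space UNIV)"
        by (simp add: nn_integral_cmult[symmetric] mult_ac)
      \<comment> \<open>Tonelli: with \<open>k\<close> fixed, the sum over \<open>m\<close> becomes
        the geometric series \<open>geo\<close>.\<close>
      also have "\<dots> = (\<integral>\<^sup>+ k. \<integral>\<^sup>+ m. ennreal C * ((H k + ennreal (ek k)) * (ennreal (2 powr (p * real_of_int m)) *
           ennreal (2 powr (q * (real_of_int k + 1 - real_of_int m))) * indicator {m - int c0..} k)) \<partial>count_space UNIV \<partial>count_space UNIV)"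
        by (rule nn_integral_count_space_nn_integral) auto
      also have "\<dots> = (\<integral>\<^sup>+ k. ennreal C * ((H k + ennreal (ek k)) * ennreal (B * 2 powr (p * real_of_int k))) \<partial>count_space UNIV)"
        unfolding geo[symmetric] by (simp add: nn_integral_cmult)
      also have "\<dots> = (\<integral>\<^sup>+ k. ennreal (C * B) * (ennreal (2 powr (p * real_of_int k)) * H k + ennreal (e * (1/2) ^ to_nat k)) \<partial>count_space UNIV)"
      proof (rule nn_integral_cong, goal_cases)
        case (1 k)
        have "2 powr (p * real_of_int k) * ek k = e * (1/2) ^ to_nat k"
          by (simp add: ek_def powr_minus)
        then have "ennreal (e * (1/2) ^ to_nat k) = ennreal (2 powr (p * real_of_int k)) * ennreal (ek k)"
          by (simp add: ennreal_mult'[symmetric])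
        then show ?case using C B by (simp add: ennreal_mult distrib_left distrib_right mult_ac)
      qed
      also have "\<dots> = ennreal (C * B) * (?Y + (\<integral>\<^sup>+ k. ennreal (e * (1/2) ^ to_nat (k::int)) \<partial>count_space UNIV))"
        by (simp add: nn_integral_cmult nn_integral_add)
      also have "(\<integral>\<^sup>+ k. ennreal (e * (1/2) ^ to_nat (k::int)) \<partial>count_space UNIV) \<le> ennreal (2 * e)"
      proof -
        have "(\<integral>\<^sup>+ k. ennreal (e * (1/2) ^ to_nat (k::int)) \<partial>count_space UNIV)
           = (\<integral>\<^sup>+ n. ennreal (e * (1/2) ^ n) \<partial>count_space (range (to_nat :: int \<Rightarrow> nat)))"
          by (rule nn_integral_bij_count_space) (rule inj_on_imp_bij_betw, simp)
        also have "\<dots> = (\<integral>\<^sup>+ n. ennreal (e * (1/2) ^ n) * indicator (range (to_nat :: int \<Rightarrow> nat)) n \<partial>count_space UNIV)"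
          by (rule nn_integral_count_space_indicator) simp
        also have "\<dots> \<le> (\<integral>\<^sup>+ n. ennreal (e * (1/2) ^ n) \<partial>count_space UNIV)"
          by (intro nn_integral_mono) (auto simp: indicator_def)
        also have "\<dots> = (\<Sum>n. ennreal (e * (1/2) ^ n))" by (rule nn_integral_count_space_nat)
        also have "\<dots> = ennreal (e * (1 / (1 - 1/2)))"
          using e by (intro suminf_ennreal_eq sums_mult geometric_sums) auto
        finally show ?thesis by (simp add: mult.commute)
      qed
      finally show ?thesis by (simp add: add_left_mono mult_left_mono)
    qed
    \<comment> \<open>The covering error is removed by letting the tolerance tend to 0.\<close>
    have XY: "?X \<le> ennreal (C * B) * ?Y"
    proof (rule ennreal_le_epsilon)
      fix e :: real assume "e > 0"
      define e' where "e' = e / (2 * (C * B))"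
      have e': "e' > 0" "C * B * (2 * e') = e" using \<open>e > 0\<close> C B by (auto simp: e'_def)
      have "?X \<le> ennreal (C * B) * (?Y + ennreal (2 * e'))" by (rule eps[OF e'(1)])
      also have "\<dots> = ennreal (C * B) * ?Y + ennreal e"
        using C B e' by (simp only: distrib_left) (simp add: ennreal_mult[symmetric])
      finally show "?X \<le> ennreal (C * B) * ?Y + ennreal e" .
    qed
    have "ennreal d * ?Y = (\<integral>\<^sup>+ k. ennreal ((1/2) powr p * (2 powr p - 1) * 2 powr (p * real_of_int k)) *
        hausdorff_content \<delta> {x\<in>\<Omega>. f x > 2 * (1/2) * 2 powr k} \<partial>count_space UNIV)"
      using d unfolding d_def[symmetric]
      by (subst nn_integral_cmult[symmetric]) (simp_all add: H_def ennreal_mult' mult.assoc)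
    also have "\<dots> \<le> choquet_integral \<delta> \<Omega> (\<lambda>x. f x powr p)"
      using p0 by (intro dyadic_le_choquet_integral_powr) auto
    finally have dY: "ennreal d * ?Y \<le> choquet_integral \<delta> \<Omega> (\<lambda>x. f x powr p)" .
    have "ennreal (C * B) * ?Y = ennreal (C * B / d) * (ennreal d * ?Y)"
      using C B d by (simp add: mult.assoc[symmetric] ennreal_mult[symmetric])
    also have "\<dots> \<le> ennreal (C * B / d) * choquet_integral \<delta> \<Omega> (\<lambda>x. f x powr p)"
      using dY by (rule mult_left_mono) simp
    finally show "?X \<le> ennreal (C * B / d) * choquet_integral \<delta> \<Omega> (\<lambda>x. f x powr p)"
      using XY by simp
  qed
qed

section \<open>The Poincare inequality for the Choquet integral\<close>

theorem theorem4p4: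
  fixes \<Omega> :: "'a::euclidean_space set" and s \<delta> p :: real
  assumes "DIM('a) \<ge> 2"
    and "s_John_domain s \<Omega>"
    and "1 \<le> s" and "s < real DIM('a) / (real DIM('a) - 1)"
    and "0 < \<delta>" and "\<delta> \<le> real DIM('a)"
    and "p > \<delta> / real DIM('a)"
  shows "\<exists>c::real. c > 0 \<and>
    (\<forall>(u::'a \<Rightarrow> real) (g::'a \<Rightarrow> 'a).
       (\<forall>x\<in>\<Omega>. (u has_derivative (\<lambda>h. g x \<bullet> h)) (at x)) \<and> continuous_on \<Omega> g \<longrightarrow>
       (INF b::real. choquet_integral \<delta> \<Omega> (\<lambda>x. \<bar>u x - b\<bar> powr p))
         \<le> ennreal c * choquet_integral \<delta> \<Omega> (\<lambda>x. norm (g x) powr p))"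
proof -
  have op: "open \<Omega>" using assms(2) by (simp add: s_John_domain_def)
  have p: "p > 0" using assms by (meson divide_pos_pos less_trans of_nat_0_less_iff DIM_positive)
  obtain \<Lambda> \<rho> where \<Lambda>: "\<Lambda> > 0" and "\<rho> > 0"
    and pointwise: "\<And>(u :: 'a \<Rightarrow> real) g. (\<And>x. x \<in> \<Omega> \<Longrightarrow> (u has_derivative (\<lambda>h. g x \<bullet> h)) (at x)) \<Longrightarrow>
       continuous_on \<Omega> g \<Longrightarrow> u \<in> borel_measurable borel \<Longrightarrow>
       \<exists>b. \<forall>x\<in>\<Omega>. \<forall>t\<ge>0.
         (\<forall>r\<in>{0<..\<rho>}. (\<integral>\<^sup>+ y \<in> ball x r \<inter> \<Omega>. ennreal (norm (g y)) \<partial>lborel) \<le> ennreal (t * r ^ DIM('a)))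
           \<longrightarrow> \<bar>u x - b\<bar> \<le> \<Lambda> * t"
    by (rule s_John_domain_pointwise[OF assms(2,1,4)]) blast
  obtain K where K: "K > 0"
    and maximal: "\<And>(f :: 'a \<Rightarrow> real) \<Omega> E \<rho>.
      (\<And>m y. y \<in> E m \<Longrightarrow> \<exists>r\<in>{0<..\<rho>}. ennreal (2 powr real_of_int m * r ^ DIM('a)) < (\<integral>\<^sup>+ z \<in> ball y r \<inter> \<Omega>. ennreal (f z) \<partial>lborel)) \<Longrightarrow>
      (\<integral>\<^sup>+ m. ennreal (2 powr (p * real_of_int m)) * hausdorff_content \<delta> (E m) \<partial>count_space UNIV)
        \<le> ennreal K * choquet_integral \<delta> \<Omega> (\<lambda>x. f x powr p)"
    by (rule choquet_integral_maximal_le[OF assms(5-7)]) blast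
  \<comment> \<open>The factor in the lengths of the dyadic intervals with the parameter \<Lambda>
    of the pointwise bound.\<close>
  define A where "A = \<Lambda> powr p * (2 powr p - 1)"
  have A: "A > 0" using p \<Lambda> powr_less_mono[of 0 p 2] by (simp add: A_def)
  show ?thesis
  proof (intro exI[of _ "A * K"] conjI allI impI)
    show "A * K > 0" using A K by simp
    fix u :: "'a \<Rightarrow> real" and g :: "'a \<Rightarrow> 'a"
    assume ug: "(\<forall>x\<in>\<Omega>. (u has_derivative (\<lambda>h. g x \<bullet> h)) (at x)) \<and> continuous_on \<Omega> g"
    \<comment> \<open>Nothing is known about \<open>u\<close> outside \<Omega>. Its extension by 0
      is Borel on the whole space and has the same derivative at the points of the open set
      \<Omega>.\<close>
    define U where "U = (\<lambda>x. indicator \<Omega> x *\<^sub>R u x)"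
    have dU: "(U has_derivative (\<lambda>h. g x \<bullet> h)) (at x)" if "x \<in> \<Omega>" for x
    proof (rule has_derivative_transform_within_open[OF _ op that])
      show "(u has_derivative (\<lambda>h. g x \<bullet> h)) (at x)" using ug that by blast
    qed (simp add: U_def)
    have "continuous_on \<Omega> u"
      using ug has_derivative_continuous by (intro continuous_at_imp_continuous_on) blast
    then have "U \<in> borel_measurable borel"
      unfolding U_def using op by (intro borel_measurable_continuous_on_indicator) auto
    from pointwise[OF dU _ this] ug obtain b where
      b: "\<And>x t. x \<in> \<Omega> \<Longrightarrow> t \<ge> 0 \<Longrightarrow>
         (\<And>r. r \<in> {0<..\<rho>} \<Longrightarrow> (\<integral>\<^sup>+ y \<in> ball x r \<inter> \<Omega>. ennreal (norm (g y)) \<partial>lborel) \<le> ennreal (t * r ^ DIM('a)))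
           \<Longrightarrow> \<bar>U x - b\<bar> \<le> \<Lambda> * t"
      by blast
    define E where "E = (\<lambda>m::int. {x\<in>\<Omega>. \<bar>u x - b\<bar> > \<Lambda> * 2 powr m})"
    \<comment> \<open>If no such radius existed, the pointwise bound with
      \<open>t = 2 powr m\<close> would contradict membership in \<open>E m\<close>. Thus these
      level sets are admissible in the maximal inequality for \<open>norm (g x)\<close>.\<close>
    have E: "\<exists>r\<in>{0<..\<rho>}. ennreal (2 powr m * r ^ DIM('a)) < (\<integral>\<^sup>+ z \<in> ball y r \<inter> \<Omega>. ennreal (norm (g z)) \<partial>lborel)"
      if "y \<in> E m" for m y
    proof (rule ccontr)
      assume "\<not> ?thesis"
      then have "\<bar>U y - b\<bar> \<le> \<Lambda> * 2 powr m"
        using that by (intro b) (auto simp: E_def not_less)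
      then show False using that by (simp add: E_def U_def)
    qed
    have "(INF b::real. choquet_integral \<delta> \<Omega> (\<lambda>x. \<bar>u x - b\<bar> powr p)) \<le> choquet_integral \<delta> \<Omega> (\<lambda>x. \<bar>u x - b\<bar> powr p)"
      by (rule INF_lower) simp
    also have "\<dots> \<le> (\<integral>\<^sup>+ m. ennreal (A * 2 powr (p * real_of_int m)) * hausdorff_content \<delta> (E m) \<partial>count_space UNIV)"
      unfolding E_def A_def by (rule choquet_integral_powr_le_dyadic[OF p \<Lambda>]) simp
    also have "\<dots> = ennreal A * (\<integral>\<^sup>+ m. ennreal (2 powr (p * real_of_int m)) * hausdorff_content \<delta> (E m) \<partial>count_space UNIV)"
      using A by (subst nn_integral_cmult[symmetric]) (auto simp: ennreal_mult mult_ac)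
    also have "\<dots> \<le> ennreal A * (ennreal K * choquet_integral \<delta> \<Omega> (\<lambda>x. norm (g x) powr p))"
      by (intro mult_left_mono maximal[where \<rho> = \<rho>]) (erule E | simp)+
    finally show "(INF b::real. choquet_integral \<delta> \<Omega> (\<lambda>x. \<bar>u x - b\<bar> powr p))
       \<le> ennreal (A * K) * choquet_integral \<delta> \<Omega> (\<lambda>x. norm (g x) powr p)"
      using A K by (simp add: ennreal_mult mult.assoc)
  qed
qed

end
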